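(* Let $f(x)=\frac{\Gamma(x)^2}{2\Gamma(2x)}$ for $x>0$. Then $$\sum_{k=1}^{\infty}f'(k)=-\frac32L_{-3}(2),$$ $$\sum_{k=1}^{\infty}f''(k)=3L_{-3}(3)=\frac{4\pi^3}{27\sqrt3},$$ $$\sum_{k=1}^{\infty}f'''(k)=\frac34\left(2\pi^2L_{-3}(2)-27L_{-3}(4)\right).$$
   Context: $\chi_{-3}$ is the primitive Dirichlet character modulo $3$: $\chi_{-3}(n)=0,1,-1$ according as $n\equiv0,1,2\pmod 3$. $L_{-3}(s)=\sum_{n=1}^\infty\chi_{-3}(n)n^{-s}$ for $\Re s>0$. *)

theory Defs
  imports "HOL-Analysis.Analysis"
begin

definition chi_m3 :: "nat \<Rightarrow> int" where
  "chi_m3 n = (if n mod 3 = 0 then 0 else if n mod 3 = 1 then 1 else - 1)"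

text \<open>
  The series is taken in its natural order, since for \<open>0 < Re s \<le> 1\<close> it converges only
  conditionally. For \<open>Re s \<le> 0\<close> the value is not meaningful.
\<close>

definition L_m3 :: "complex \<Rightarrow> complex" where
  "L_m3 s = (\<Sum>n. of_int (chi_m3 (Suc n)) * of_nat (Suc n) powr (- s))"

end

theory Submission
  imports Defs "HOL-Complex_Analysis.Complex_Analysis"
begin

text \<open>
  Since \<open>f(x) = B(x,x)/2\<close>, the derivatives of \<open>f\<close> are integrals of powers of \<open>ln (t(1-t))\<close> against
  \<open>(t(1-t))\<^sup>x\<^sup>-\<^sup>1/2\<close> on the unit interval, and summing the geometric series over \<open>x = k\<close> leaves
  the integral of \<open>(a+b)\<^sup>m/2\<close> against \<open>dt/(1-t+t\<^sup>2)\<close>, where \<open>a = ln t\<close> and \<open>b = ln (1-t)\<close>.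
  Pure powers of \<open>a\<close> or \<open>b\<close> give \<open>L\<close>-values by expanding the kernel into a power series.

  The mixed moments come from a symmetry: up to a constant, \<open>dt/(1-t+t\<^sup>2)\<close> is the harmonic measure of
  the upper half plane seen from \<open>\<rho> = e^(i\<pi>/3)\<close>, which is invariant under the order 3 map
  \<open>t \<mapsto> 1/(1-t)\<close> cycling the intervals \<open>(0,1)\<close>, \<open>(1,\<infinity>)\<close>, \<open>(-\<infinity>,0)\<close>. Summing a monomial in \<open>log t\<close> and
  \<open>log (1-t)\<close> over this action gives an invariant holomorphic function, whose mean over \<open>(0,1)\<close>
  alone is its value at \<open>\<rho>\<close>. The monomial \<open>ab\<close> yields the second moment and \<open>a\<^sup>2b\<close> the third.
\<close>

section \<open>Moments of a logarithm\<close>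

lemma power_div_fact_le_exp:
  fixes y :: real
  assumes "y \<ge> 0"
  shows "y ^ m / fact m \<le> exp y"
proof -
  have "(\<Sum>n\<in>{m}. y ^ n /\<^sub>R fact n) \<le> (\<Sum>n. y ^ n /\<^sub>R fact n)"
    using assms summable_exp_generic[of y] by (intro sum_le_suminf) auto
  then show ?thesis by (simp add: exp_def divide_inverse mult.commute)
qed

lemma abs_exp_diff_le:
  fixes a b :: real
  assumes "a \<le> c" "b \<le> c"
  shows "\<bar>exp a - exp b\<bar> \<le> \<bar>a - b\<bar> * exp c"
proof -
  have *: "exp u - exp v \<le> (u - v) * exp c" if "v \<le> u" "u \<le> c" for u v :: real
  proof -
    have "exp u - exp v = exp u * (1 - exp (v - u))"
      by (simp add: exp_diff algebra_simps)
    also have "\<dots> \<le> exp u * (u - v)"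
      using exp_ge_add_one_self[of "v - u"] by (intro mult_left_mono; simp; linarith)
    also have "\<dots> \<le> exp c * (u - v)"
      using that by (intro mult_right_mono) auto
    finally show ?thesis by (simp add: mult.commute)
  qed
  show ?thesis
    using *[of a b] *[of b a] assms by (cases "a \<le> b") (auto simp: abs_if)
qed

text \<open>Half of the decay pays for the power: with y = -(x/2) L t, which is nonnegative, the
  exponential series bounds y^m by m! exp y, and exp y * exp (x L t) is the integrand of the
  hypothesis at x/2.\<close>

lemma integrable_log_moment:
  fixes w L :: "'a \<Rightarrow> real"
  assumes [measurable]: "w \<in> borel_measurable M" "L \<in> borel_measurable M"
    and nonpos: "\<And>t. t \<in> space M \<Longrightarrow> L t \<le> 0"
    and int: "\<And>x. x > 0 \<Longrightarrow> integrable M (\<lambda>t. w t * exp (x * L t))"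
    and "x > 0"
  shows "integrable M (\<lambda>t. w t * L t ^ m * exp (x * L t))"
proof (rule Bochner_Integration.integrable_bound)
  show "integrable M (\<lambda>t. fact m / (x / 2) ^ m * (w t * exp ((x / 2) * L t)))"
    using \<open>x > 0\<close> by (intro integrable_mult_right int) auto
  show "AE t in M. norm (w t * L t ^ m * exp (x * L t)) \<le>
          norm (fact m / (x / 2) ^ m * (w t * exp ((x / 2) * L t)))"
  proof (rule AE_I2)
    fix t assume "t \<in> space M"
    then have "L t \<le> 0" by (rule nonpos)
    define y where "y = - (x / 2) * L t"
    have "y \<ge> 0" using \<open>L t \<le> 0\<close> \<open>x > 0\<close> by (simp add: y_def mult_nonneg_nonpos)
    have "\<bar>L t\<bar> ^ m * (x / 2) ^ m = y ^ m"
      using \<open>L t \<le> 0\<close> by (simp add: y_def mult.commute flip: power_mult_distrib)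
    also have "\<dots> \<le> fact m * exp y"
      using power_div_fact_le_exp[OF \<open>y \<ge> 0\<close>, of m] by (simp add: field_simps)
    finally have "\<bar>L t\<bar> ^ m \<le> fact m / (x / 2) ^ m * exp y"
      using \<open>x > 0\<close> by (simp add: field_simps)
    then have "\<bar>w t\<bar> * \<bar>L t\<bar> ^ m * exp (x * L t) \<le> \<bar>w t\<bar> * (fact m / (x / 2) ^ m * exp y) * exp (x * L t)"
      by (intro mult_right_mono mult_left_mono) auto
    also have "\<dots> = fact m / (x / 2) ^ m * (\<bar>w t\<bar> * (exp y * exp (x * L t)))" by simp
    also have "exp y * exp (x * L t) = exp ((x / 2) * L t)"
      by (simp add: y_def flip: exp_add)
    finally show "norm (w t * L t ^ m * exp (x * L t)) \<le>
          norm (fact m / (x / 2) ^ m * (w t * exp ((x / 2) * L t)))"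
      using \<open>x > 0\<close> by (simp add: abs_mult power_abs)
  qed
qed measurable

text \<open>Differentiation under the integral, by dominated convergence along an arbitrary null
  sequence. As long as the increment is smaller than x/2, every difference quotient is dominated by
  the next moment taken at x/2.\<close>

lemma has_field_derivative_log_moment:
  fixes w L :: "'a \<Rightarrow> real"
  assumes meas [measurable]: "w \<in> borel_measurable M" "L \<in> borel_measurable M"
    and nonpos: "\<And>t. t \<in> space M \<Longrightarrow> L t \<le> 0"
    and int: "\<And>x. x > 0 \<Longrightarrow> integrable M (\<lambda>t. w t * exp (x * L t))"
    and "x > 0"
  shows "((\<lambda>x. \<integral>t. w t * L t ^ m * exp (x * L t) \<partial>M) has_field_derivative
           (\<integral>t. w t * L t ^ Suc m * exp (x * L t) \<partial>M)) (at x)"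
  unfolding DERIV_def tendsto_at_iff_sequentially comp_def
proof (intro allI impI)
  note integrable = integrable_log_moment[OF meas nonpos int]
  fix X :: "nat \<Rightarrow> real"
  assume X0: "\<forall>i. X i \<in> UNIV - {0}" and X: "X \<longlonglongrightarrow> 0"
  \<comment> \<open>Shifting the sequence by N keeps \<open>x + X (i + N)\<close> above x/2, where
    one integrable bound serves all i; \<open>LIMSEQ_offset\<close> undoes the shift at the
    end.\<close>
  from X have "\<forall>\<^sub>F i in sequentially. dist (X i) 0 < x / 2"
    using \<open>x > 0\<close> by (intro tendstoD) auto
  then obtain N where N: "\<And>i. i \<ge> N \<Longrightarrow> \<bar>X i\<bar> < x / 2"
    by (auto simp: eventually_sequentially)
  let ?q = "\<lambda>i t. w t * L t ^ m * ((exp ((x + X (i + N)) * L t) - exp (x * L t)) / X (i + N))"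
  have "(\<lambda>i. \<integral>t. ?q i t \<partial>M) \<longlonglongrightarrow> (\<integral>t. w t * L t ^ Suc m * exp (x * L t) \<partial>M)"
  proof (rule integral_dominated_convergence)
    show "integrable M (\<lambda>t. norm (w t * L t ^ Suc m * exp (x / 2 * L t)))"
      using \<open>x > 0\<close> by (intro integrable_norm integrable) auto
    show "AE t in M. (\<lambda>i. ?q i t) \<longlonglongrightarrow> w t * L t ^ Suc m * exp (x * L t)"
    proof (rule AE_I2)
      fix t
      have "((\<lambda>x. exp (x * L t)) has_field_derivative L t * exp (x * L t)) (at x)"
        by (auto intro!: derivative_eq_intros)
      then have "(\<lambda>i. (exp ((x + X (i + N)) * L t) - exp (x * L t)) / X (i + N))
          \<longlonglongrightarrow> L t * exp (x * L t)"
        unfolding DERIV_def tendsto_at_iff_sequentially comp_def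
        using X0 LIMSEQ_ignore_initial_segment[OF X, of N] by simp
      from tendsto_mult_left[OF this, of "w t * L t ^ m"]
      show "(\<lambda>i. ?q i t) \<longlonglongrightarrow> w t * L t ^ Suc m * exp (x * L t)"
        by (simp add: mult_ac)
    qed
    fix i
    show "AE t in M. norm (?q i t) \<le> norm (w t * L t ^ Suc m * exp (x / 2 * L t))"
    proof (rule AE_I2)
      fix t assume "t \<in> space M"
      then have L: "L t \<le> 0" by (rule nonpos)
      define h where "h = X (i + N)"
      have h: "\<bar>h\<bar> < x / 2" "h \<noteq> 0" using N[of "i + N"] X0 by (auto simp: h_def)
      have "\<bar>exp ((x + h) * L t) - exp (x * L t)\<bar> \<le> \<bar>(x + h) * L t - x * L t\<bar> * exp (x / 2 * L t)"
        using h L by (intro abs_exp_diff_le mult_right_mono_neg) auto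
      also have "(x + h) * L t - x * L t = h * L t" by (simp add: algebra_simps)
      finally have "\<bar>(exp ((x + h) * L t) - exp (x * L t)) / h\<bar> \<le> \<bar>L t\<bar> * exp (x / 2 * L t)"
        using h by (simp add: field_simps abs_mult)
      then have "\<bar>w t * L t ^ m\<bar> * \<bar>(exp ((x + h) * L t) - exp (x * L t)) / h\<bar> \<le>
          \<bar>w t * L t ^ m\<bar> * (\<bar>L t\<bar> * exp (x / 2 * L t))"
        by (rule mult_left_mono) auto
      then show "norm (?q i t) \<le> norm (w t * L t ^ Suc m * exp (x / 2 * L t))"
        by (simp add: abs_mult h_def mult_ac)
    qed
  qed measurable
  moreover have "(\<integral>t. ?q i t \<partial>M) = ((\<integral>t. w t * L t ^ m * exp ((x + X (i + N)) * L t) \<partial>M) -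
      (\<integral>t. w t * L t ^ m * exp (x * L t) \<partial>M)) / X (i + N)" for i
  proof -
    have "x + X (i + N) > 0" using N[of "i + N"] \<open>x > 0\<close> by (auto simp: abs_if split: if_splits)
    then have diff: "(\<integral>t. w t * L t ^ m * exp ((x + X (i + N)) * L t) - w t * L t ^ m * exp (x * L t) \<partial>M) =
        (\<integral>t. w t * L t ^ m * exp ((x + X (i + N)) * L t) \<partial>M) -
        (\<integral>t. w t * L t ^ m * exp (x * L t) \<partial>M)"
      using \<open>x > 0\<close> by (intro Bochner_Integration.integral_diff integrable)
    have "(\<integral>t. ?q i t \<partial>M) = (\<integral>t. (w t * L t ^ m * exp ((x + X (i + N)) * L t) -
        w t * L t ^ m * exp (x * L t)) / X (i + N) \<partial>M)"
      by (simp only: right_diff_distrib times_divide_eq_right)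
    then show ?thesis
      by (simp only: integral_divide_zero diff)
  qed
  ultimately have "(\<lambda>i. ((\<integral>t. w t * L t ^ m * exp ((x + X (i + N)) * L t) \<partial>M) -
      (\<integral>t. w t * L t ^ m * exp (x * L t) \<partial>M)) / X (i + N))
      \<longlonglongrightarrow> (\<integral>t. w t * L t ^ Suc m * exp (x * L t) \<partial>M)"
    by (simp only:)
  then show "(\<lambda>i. ((\<integral>t. w t * L t ^ m * exp ((x + X i) * L t) \<partial>M) -
      (\<integral>t. w t * L t ^ m * exp (x * L t) \<partial>M)) / X i)
      \<longlonglongrightarrow> (\<integral>t. w t * L t ^ Suc m * exp (x * L t) \<partial>M)"
    by (rule LIMSEQ_offset)
qed

text \<open>Nothing is known about \<open>f\<close> off the positive reals. The half-line is open,
  so agreement there is enough to differentiate once more at each induction step.\<close>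

lemma higher_deriv_log_moment:
  fixes w L :: "'a \<Rightarrow> real"
  assumes meas: "w \<in> borel_measurable M" "L \<in> borel_measurable M"
    and nonpos: "\<And>t. t \<in> space M \<Longrightarrow> L t \<le> 0"
    and int: "\<And>x. x > 0 \<Longrightarrow> integrable M (\<lambda>t. w t * exp (x * L t))"
    and f: "\<And>x. x > 0 \<Longrightarrow> f x = (\<integral>t. w t * exp (x * L t) \<partial>M)"
    and "x > 0"
  shows "(deriv ^^ m) f x = (\<integral>t. w t * L t ^ m * exp (x * L t) \<partial>M)"
  using \<open>x > 0\<close>
proof (induction m arbitrary: x)
  case 0
  then show ?case using f by simp
next
  case (Suc m)
  have "((deriv ^^ m) f has_field_derivative
      (\<integral>t. w t * L t ^ Suc m * exp (x * L t) \<partial>M)) (at x)"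
    using has_field_derivative_log_moment[OF meas nonpos int Suc.prems]
    by (rule has_field_derivative_transform_within_open[where S = "{0<..}"])
       (use Suc in auto)
  then show ?case by (simp add: DERIV_imp_deriv)
qed

section \<open>Lebesgue measure on the unit interval\<close>

text \<open>The endpoints are excluded so that \<open>t\<close> and \<open>1 - t\<close> are
  positive on the whole space and pointwise facts about their logarithms need no exceptional
  points.\<close>

definition unit_measure :: "real measure" where
  "unit_measure = restrict_space lborel {0<..<1}"

lemma space_unit_measure [simp]: "space unit_measure = {0<..<1}"
  by (simp add: unit_measure_def space_restrict_space)

lemma measurable_unit_measure [measurable (raw)]:
  "f \<in> borel_measurable borel \<Longrightarrow> f \<in> borel_measurable unit_measure"
  unfolding unit_measure_def by (intro measurable_restrict_space1) simp

text \<open>Nonnegativity upgrades gauge integrability to absolute integrability, which carries the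
  Beta integral over to the Lebesgue setting.\<close>

lemma has_bochner_integral_unit_measure:
  fixes f :: "real \<Rightarrow> real"
  assumes "(f has_integral I) {0<..<1}" "f \<in> borel_measurable borel"
    and "\<And>t. 0 < t \<Longrightarrow> t < 1 \<Longrightarrow> f t \<ge> 0"
  shows "has_bochner_integral unit_measure f I"
proof -
  have "f absolutely_integrable_on {0<..<1}"
    using assms by (intro nonnegative_absolutely_integrable_1) auto
  then have int: "set_integrable lborel {0<..<1} f"
    using assms(2) by (simp add: set_integrable_def integrable_completion)
  have "(LINT t:{0<..<1}|lborel. f t) = I"
    using set_borel_integral_eq_integral(2)[OF int] assms(1) by (simp add: integral_unique)
  then show ?thesis
    using int by (simp add: unit_measure_def has_bochner_integral_iff integrable_restrict_space
      integral_restrict_space set_integrable_def set_lebesgue_integral_def)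
qed

lemma integral_unit_measure_eq_integral:
  fixes f :: "real \<Rightarrow> 'a :: euclidean_space"
  assumes "integrable unit_measure f"
  shows "integral\<^sup>L unit_measure f = integral {0..1} f"
proof -
  from assms have "set_integrable lborel {0<..<1} f"
    by (simp add: unit_measure_def integrable_restrict_space set_integrable_def)
  from set_borel_integral_eq_integral(2)[OF this] show ?thesis
    by (simp add: unit_measure_def integral_restrict_space set_lebesgue_integral_def
      integral_open_interval_real)
qed

lemma integral_unit_measure_reflect:
  fixes f :: "real \<Rightarrow> 'a :: euclidean_space"
  shows "(\<integral>t. f (1 - t) \<partial>unit_measure) = (\<integral>t. f t \<partial>unit_measure)"
proof -
  have "(\<integral>t. f t \<partial>unit_measure) = (\<integral>t. indicator {0<..<1} (1 - t) *\<^sub>R f (1 - t) \<partial>lborel)"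
    unfolding unit_measure_def
    by (subst integral_restrict_space, simp)
       (subst lborel_integral_real_affine[where c = "-1" and t = 1], simp_all)
  also have "\<dots> = (\<integral>t. f (1 - t) \<partial>unit_measure)"
    unfolding unit_measure_def
    by (subst integral_restrict_space, simp)
       (intro Bochner_Integration.integral_cong, auto simp: indicator_def)
  finally show ?thesis by simp
qed

lemma integrable_unit_measure_reflect:
  fixes f :: "real \<Rightarrow> 'a :: euclidean_space"
  assumes "integrable unit_measure f"
  shows "integrable unit_measure (\<lambda>t. f (1 - t))"
proof -
  have "integrable lborel (\<lambda>t. indicator {0<..<1} t *\<^sub>R f t)"
    using assms by (simp add: unit_measure_def integrable_restrict_space)
  from lborel_integrable_real_affine[OF this, of "-1" 1]
  show ?thesis
    by (simp add: unit_measure_def integrable_restrict_space indicator_def conj_commute)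
qed

section \<open>Beta integrals and the moments of powers of t and ln t\<close>

lemma has_bochner_integral_Beta:
  fixes a b :: real
  assumes "a > 0" "b > 0"
  shows "has_bochner_integral unit_measure (\<lambda>t. t powr (a - 1) * (1 - t) powr (b - 1)) (Beta a b)"
  using has_integral_Beta_real[OF assms]
  by (intro has_bochner_integral_unit_measure) (auto simp: has_integral_Icc_iff_Ioo)

text \<open>Brings B(x,x)/2 into the shape required by \<open>higher_deriv_log_moment\<close>, with
  L = ln (t(1-t)) and the weight absorbing the shift from x - 1 to x.\<close>

lemma has_bochner_integral_central_Beta:
  fixes x :: real
  assumes "x > 0"
  shows "has_bochner_integral unit_measure
    (\<lambda>t. 1 / (2 * (t * (1 - t))) * exp (x * ln (t * (1 - t)))) (Gamma x ^ 2 / (2 * Gamma (2 * x)))"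
proof -
  have "has_bochner_integral unit_measure (\<lambda>t. t powr (x - 1) * (1 - t) powr (x - 1) / 2)
      (Beta x x / 2)"
    by (intro has_bochner_integral_divide_zero has_bochner_integral_Beta assms)
  also have "Beta x x / 2 = Gamma x ^ 2 / (2 * Gamma (2 * x))"
    by (simp add: Beta_def power2_eq_square flip: mult_2)
  also have "has_bochner_integral unit_measure (\<lambda>t. t powr (x - 1) * (1 - t) powr (x - 1) / 2) = 
     has_bochner_integral unit_measure (\<lambda>t. 1 / (2 * (t * (1 - t))) * exp (x * ln (t * (1 - t))))"
  proof (intro ext has_bochner_integral_cong)
    fix t assume "t \<in> space unit_measure"
    then have "t > 0" "1 - t > 0" by auto
    then have "t powr (x - 1) * (1 - t) powr (x - 1) = (t * (1 - t)) powr (x - 1)"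
      by (simp add: powr_mult)
    also have "\<dots> = exp ((x - 1) * ln (t * (1 - t)))"
      using \<open>t > 0\<close> \<open>1 - t > 0\<close> by (simp add: powr_def)
    also have "\<dots> = exp (x * ln (t * (1 - t))) / (t * (1 - t))"
      using \<open>t > 0\<close> \<open>1 - t > 0\<close> by (simp add: left_diff_distrib exp_diff)
    finally show "t powr (x - 1) * (1 - t) powr (x - 1) / 2 =
        1 / (2 * (t * (1 - t))) * exp (x * ln (t * (1 - t)))" by simp
  qed auto
  finally show ?thesis .
qed

text \<open>The same shape for B(x,1) = 1/x, with L = ln t.\<close>

lemma has_bochner_integral_exp_ln:
  fixes x :: real
  assumes "x > 0"
  shows "has_bochner_integral unit_measure (\<lambda>t. 1 / t * exp (x * ln t)) (1 / x)"
proof -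
  have "has_bochner_integral unit_measure (\<lambda>t. t powr (x - 1) * (1 - t) powr (1 - 1)) (Beta x 1)"
    by (intro has_bochner_integral_Beta assms) simp
  also have "Beta x 1 = 1 / x"
  proof -
    have "x \<notin> \<int>\<^sub>\<le>\<^sub>0" using assms by auto
    then show ?thesis
      using Gamma_plus1[of x] by (simp add: Beta_def Gamma_eq_zero_iff)
  qed
  also have "has_bochner_integral unit_measure (\<lambda>t. t powr (x - 1) * (1 - t) powr (1 - 1)) = 
     has_bochner_integral unit_measure (\<lambda>t. 1 / t * exp (x * ln t))"
    by (intro ext has_bochner_integral_cong)
       (auto simp: powr_def exp_diff algebra_simps divide_simps)
  finally show ?thesis .
qed

lemma higher_deriv_reciprocal:
  fixes x :: real
  assumes "x > 0"
  shows "(deriv ^^ m) (\<lambda>x. 1 / x) x = (- 1) ^ m * fact m / x ^ Suc m"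
  using assms
proof (induction m arbitrary: x)
  case (Suc m)
  have "((\<lambda>x. (- 1) ^ m * fact m / x ^ Suc m) has_field_derivative
      ((- 1) ^ Suc m * fact (Suc m) / x ^ Suc (Suc m))) (at x)"
    using Suc.prems
    by (auto intro!: derivative_eq_intros simp: divide_simps simp del: power_Suc)
       (simp add: algebra_simps power_add)
  then have "((deriv ^^ m) (\<lambda>x. 1 / x) has_field_derivative
      ((- 1) ^ Suc m * fact (Suc m) / x ^ Suc (Suc m))) (at x)"
    by (rule has_field_derivative_transform_within_open[where S = "{0<..}"])
       (use Suc in auto)
  then show ?case by (simp add: DERIV_imp_deriv)
qed auto

text \<open>The integral is the m-th derivative of 1/x at x = n + 1, taken under the integral sign;
  the weight 1/t lowers the exponent from n + 1 to n.\<close>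

lemma
  shows integrable_power_ln: "integrable unit_measure (\<lambda>t. t ^ n * ln t ^ m)"
    and integral_power_ln:
      "(\<integral>t. t ^ n * ln t ^ m \<partial>unit_measure) = (- 1) ^ m * fact m / real (Suc n) ^ Suc m"
proof -
  have eq: "1 / t * ln t ^ m * exp (real (Suc n) * ln t) = t ^ n * ln t ^ m"
    if "t \<in> space unit_measure" for t
    using that by (auto simp: exp_of_nat_mult exp_add algebra_simps)
  have "integrable unit_measure (\<lambda>t. 1 / t * ln t ^ m * exp (real (Suc n) * ln t))"
    using has_bochner_integral_exp_ln
    by (intro integrable_log_moment) (auto simp: has_bochner_integral_iff)
  then show "integrable unit_measure (\<lambda>t. t ^ n * ln t ^ m)"
    by (subst (asm) Bochner_Integration.integrable_cong[OF refl eq]) auto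
  have "(deriv ^^ m) (\<lambda>x. 1 / x) (real (Suc n)) =
      (\<integral>t. 1 / t * ln t ^ m * exp (real (Suc n) * ln t) \<partial>unit_measure)"
    using has_bochner_integral_exp_ln
    by (intro higher_deriv_log_moment) (auto simp: has_bochner_integral_iff)
  also have "\<dots> = (\<integral>t. t ^ n * ln t ^ m \<partial>unit_measure)"
    by (intro Bochner_Integration.integral_cong refl eq)
  finally show "(\<integral>t. t ^ n * ln t ^ m \<partial>unit_measure) = (- 1) ^ m * fact m / real (Suc n) ^ Suc m"
    by (simp add: higher_deriv_reciprocal del: of_nat_Suc)
qed

text \<open>Termwise integration of a power series with bounded coefficients. The integrals of the
  norms are at most m!/(n+1)^(m+1), which is summable because m is at least 1.\<close>

lemma sums_integral_power_ln:
  fixes c :: "nat \<Rightarrow> real"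
  assumes c: "\<And>n. \<bar>c n\<bar> \<le> 1" and "m \<ge> 1"
    and h: "\<And>t. 0 < t \<Longrightarrow> t < 1 \<Longrightarrow> (\<lambda>n. c n * t ^ n) sums h t"
  shows "(\<lambda>n. c n / real (Suc n) ^ Suc m) sums
    ((- 1) ^ m / fact m * (\<integral>t. ln t ^ m * h t \<partial>unit_measure))"
proof -
  let ?f = "\<lambda>n t. c n * (t ^ n * ln t ^ m)"
  have "(\<lambda>n. \<integral>t. ?f n t \<partial>unit_measure) sums (\<integral>t. (\<Sum>n. ?f n t) \<partial>unit_measure)"
  proof (rule sums_integral)
    show "AE t in unit_measure. summable (\<lambda>n. norm (?f n t))"
    proof (rule AE_I2)
      fix t assume "t \<in> space unit_measure"
      then have t: "0 < t" "t < 1" by auto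
      have "summable (\<lambda>n. norm (c n * t ^ n))"
      proof (rule summable_comparison_test)
        show "summable (\<lambda>n. t ^ n)" using t by (intro summable_geometric) auto
        show "\<exists>N. \<forall>n\<ge>N. norm (norm (c n * t ^ n)) \<le> t ^ n"
          using t c by (auto simp: abs_mult mult_left_le_one_le)
      qed
      from summable_mult2[OF this, of "norm (ln t ^ m)"]
      show "summable (\<lambda>n. norm (?f n t))" by (simp add: abs_mult mult_ac)
    qed
    show "summable (\<lambda>n. \<integral>t. norm (?f n t) \<partial>unit_measure)"
    proof (rule summable_comparison_test)
      show "summable (\<lambda>n. fact m * (1 / real (Suc n) ^ Suc m))"
        using inverse_power_summable[of "Suc m", where ?'a = real] \<open>m \<ge> 1\<close>
        by (intro summable_mult) (subst summable_Suc_iff, simp add: inverse_eq_divide)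
      have "(\<integral>t. norm (?f n t) \<partial>unit_measure) \<le> fact m * (1 / real (Suc n) ^ Suc m)" for n
      proof -
        have "(\<integral>t. norm (?f n t) \<partial>unit_measure) =
            (\<integral>t. \<bar>c n\<bar> * ((- 1) ^ m * (t ^ n * ln t ^ m)) \<partial>unit_measure)"
          by (intro Bochner_Integration.integral_cong)
             (auto simp: abs_mult power_abs simp flip: power_mult_distrib)
        also have "\<dots> = \<bar>c n\<bar> * (fact m * (1 / real (Suc n) ^ Suc m))"
          by (simp add: integral_power_ln del: of_nat_Suc flip: power_add mult_2)
        also have "\<dots> \<le> fact m * (1 / real (Suc n) ^ Suc m)"
          using c[of n] by (intro mult_left_le_one_le) auto
        finally show ?thesis .
      qed
      then show "\<exists>N. \<forall>n\<ge>N. norm (\<integral>t. norm (?f n t) \<partial>unit_measure) \<le> fact m * (1 / real (Suc n) ^ Suc m)"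
        by simp
    qed
  qed (simp add: integrable_power_ln)
  also have "(\<integral>t. (\<Sum>n. ?f n t) \<partial>unit_measure) = (\<integral>t. ln t ^ m * h t \<partial>unit_measure)"
  proof (rule Bochner_Integration.integral_cong)
    fix t assume "t \<in> space unit_measure"
    then have "(\<lambda>n. c n * t ^ n * ln t ^ m) sums (h t * ln t ^ m)"
      using h by (intro sums_mult2) auto
    then show "(\<Sum>n. ?f n t) = ln t ^ m * h t"
      by (simp add: sums_iff mult_ac)
  qed simp
  finally have "(\<lambda>n. (- 1) ^ m / fact m * (c n * ((- 1) ^ m * fact m / real (Suc n) ^ Suc m))) sums
      ((- 1) ^ m / fact m * (\<integral>t. ln t ^ m * h t \<partial>unit_measure))"
    by (intro sums_mult) (simp add: integral_power_ln del: of_nat_Suc)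
  moreover have "(- 1) ^ m / fact m * (c n * ((- 1) ^ m * fact m / real (Suc n) ^ Suc m)) =
      c n / real (Suc n) ^ Suc m" for n
    by (simp add: divide_simps del: of_nat_Suc power_Suc)
  ultimately show ?thesis by (simp only:)
qed

section \<open>The kernel and its power series\<close>

text \<open>The denominator is 1 - t(1-t), so this is the sum of the geometric series in
  t(1-t).\<close>

definition kern :: "real \<Rightarrow> real" where
  "kern t = 1 / (1 - t + t\<^sup>2)"

lemma kern_denom_ge: "1 - t + t\<^sup>2 \<ge> 3 / (4 :: real)"
proof -
  have "1 - t + t\<^sup>2 = 3 / 4 + (t - 1 / 2)\<^sup>2" by (simp add: power2_eq_square algebra_simps)
  then show ?thesis by simp
qed

lemma kern_denom_pos: "1 - t + t\<^sup>2 > (0 :: real)"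
  using kern_denom_ge[of t] by linarith

lemma kern_pos: "kern t > 0"
  using kern_denom_pos by (simp add: kern_def)

lemma kern_le: "kern t \<le> 4 / 3"
  using kern_denom_ge[of t] kern_denom_pos[of t] by (simp add: kern_def field_simps)

lemma measurable_kern [measurable]: "kern \<in> borel_measurable borel"
  unfolding kern_def by measurable

lemma kern_reflect: "kern (1 - t) = kern t"
  by (simp add: kern_def power2_eq_square algebra_simps)

lemma chi_m3_sum: "chi_m3 n + chi_m3 (Suc n) + chi_m3 (Suc (Suc n)) = 0"
  by (simp add: chi_m3_def mod_Suc) linarith

lemma abs_chi_m3_le: "\<bar>chi_m3 n\<bar> \<le> 1"
  by (simp add: chi_m3_def)

lemma chi_m3_double: "chi_m3 (2 * n) = - chi_m3 n"
proof -
  have "(2 * n) mod 3 = (2 * (n mod 3)) mod 3" by (simp add: mod_mult_right_eq)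
  moreover have "n mod 3 = 0 \<or> n mod 3 = 1 \<or> n mod 3 = 2" by linarith
  ultimately show ?thesis by (auto simp: chi_m3_def)
qed

text \<open>The Taylor coefficients 1, 1, 0, -1, -1, 0, ... of (1 + t)/(1 + t^3) = 1/(1 - t + t^2).
  The argument \<open>Suc n\<close> matches the denominator n + 1 produced by integrating
  t^n.\<close>

definition alt_chi :: "nat \<Rightarrow> real" where
  "alt_chi n = (- 1) ^ n * real_of_int (chi_m3 (Suc n))"

lemma abs_alt_chi_le: "\<bar>alt_chi n\<bar> \<le> 1"
  using abs_chi_m3_le[of "Suc n"] by (simp add: alt_chi_def abs_mult power_abs)

lemma alt_chi_rec: "alt_chi (Suc (Suc n)) = alt_chi (Suc n) - alt_chi n"
proof -
  have "real_of_int (chi_m3 (Suc n) + chi_m3 (Suc (Suc n)) + chi_m3 (Suc (Suc (Suc n)))) = 0"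
    by (simp only: chi_m3_sum)
  then have *: "real_of_int (chi_m3 (Suc (Suc (Suc n)))) =
      - real_of_int (chi_m3 (Suc n)) - real_of_int (chi_m3 (Suc (Suc n)))" by simp
  show ?thesis unfolding alt_chi_def * by (simp add: algebra_simps)
qed

lemma alt_chi_0_1: "alt_chi 0 = 1" "alt_chi (Suc 0) = 1"
  by (simp_all add: alt_chi_def chi_m3_def)

text \<open>The recurrence \<open>alt_chi_rec\<close> has 1 - t + t^2 as its polynomial, so the
  product telescopes. For 0 < t < 1 the boundary terms tend to 0, the coefficients being
  bounded.\<close>

lemma kern_partial_sum:
  "(\<Sum>n<N. alt_chi n * t ^ n) * (1 - t + t\<^sup>2) =
     1 - alt_chi N * t ^ N + (alt_chi N - alt_chi (Suc N)) * t ^ Suc N"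
  by (induction N) (simp_all add: alt_chi_0_1 alt_chi_rec algebra_simps power2_eq_square)

lemma sums_kern:
  fixes t :: real
  assumes "0 < t" "t < 1"
  shows "(\<lambda>n. alt_chi n * t ^ n) sums kern t"
proof -
  have to0: "(\<lambda>N. alt_chi (N + i) * t ^ (N + j)) \<longlonglongrightarrow> 0" for i j
  proof (rule Lim_null_comparison)
    show "(\<lambda>N. t ^ (N + j)) \<longlonglongrightarrow> 0"
      using assms by (intro LIMSEQ_ignore_initial_segment LIMSEQ_realpow_zero) auto
    show "\<forall>\<^sub>F N in sequentially. norm (alt_chi (N + i) * t ^ (N + j)) \<le> t ^ (N + j)"
      using abs_alt_chi_le assms by (auto simp: abs_mult intro!: always_eventually mult_left_le_one_le)
  qed
  have "(\<lambda>N. (1 - alt_chi (N + 0) * t ^ (N + 0) + (alt_chi (N + 0) * t ^ (N + 1) - alt_chi (N + 1) * t ^ (N + 1)))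
      / (1 - t + t\<^sup>2)) \<longlonglongrightarrow> (1 - 0 + (0 - 0)) / (1 - t + t\<^sup>2)"
    using kern_denom_pos[of t] by (intro tendsto_intros to0) auto
  moreover have "(\<Sum>n<N. alt_chi n * t ^ n) = (1 - alt_chi (N + 0) * t ^ (N + 0) +
      (alt_chi (N + 0) * t ^ (N + 1) - alt_chi (N + 1) * t ^ (N + 1))) / (1 - t + t\<^sup>2)" for N
    using kern_partial_sum[of t N] kern_denom_pos[of t] by (simp add: field_simps)
  ultimately show ?thesis
    by (simp add: sums_def kern_def)
qed

section \<open>Real L-values and the pure logarithmic moments of the kernel\<close>

definition L_real :: "nat \<Rightarrow> real" where
  "L_real s = (\<Sum>n. real_of_int (chi_m3 (Suc n)) / real (Suc n) ^ s)"

lemma summable_L_real: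
  assumes "s \<ge> 2"
  shows "summable (\<lambda>n. real_of_int (chi_m3 (Suc n)) / real (Suc n) ^ s)"
proof (rule summable_comparison_test)
  show "summable (\<lambda>n. 1 / real (Suc n) ^ s)"
    using inverse_power_summable[of s, where ?'a = real] assms
    by (subst summable_Suc_iff) (simp add: inverse_eq_divide)
  have "\<bar>real_of_int (chi_m3 (Suc n))\<bar> \<le> 1" for n
    using abs_chi_m3_le[of "Suc n"] by linarith
  then show "\<exists>N. \<forall>n\<ge>N. norm (real_of_int (chi_m3 (Suc n)) / real (Suc n) ^ s) \<le> 1 / real (Suc n) ^ s"
    by (auto simp: power_abs divide_right_mono)
qed

lemma sums_L_real:
  assumes "s \<ge> 2"
  shows "(\<lambda>n. real_of_int (chi_m3 (Suc n)) / real (Suc n) ^ s) sums L_real s"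
  using summable_L_real[OF assms] by (simp add: L_real_def summable_sums)

lemma L_m3_of_nat:
  assumes "s \<ge> 2"
  shows "L_m3 (of_nat s) = of_real (L_real s)"
proof -
  have "of_int (chi_m3 (Suc n)) * of_nat (Suc n) powr (- of_nat s :: complex) =
      complex_of_real (real_of_int (chi_m3 (Suc n)) / real (Suc n) ^ s)" for n
    by (simp add: powr_minus powr_nat divide_inverse del: of_nat_Suc)
  then show ?thesis
    using summable_L_real[OF assms] by (simp add: L_m3_def L_real_def suminf_of_real)
qed

text \<open>The sign (-1)^n is negative exactly where n + 1 is even. Since chi(2k) = -chi(k), the
  even part of the L-series is -L/2^s; subtracting it twice flips those signs and gives the factor 1
  + 2/2^s.\<close>

lemma sums_alt_chi:
  assumes "s \<ge> 2"
  shows "(\<lambda>n. alt_chi n / real (Suc n) ^ s) sums ((1 + 2 / 2 ^ s) * L_real s)"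
proof -
  let ?c = "\<lambda>n. real_of_int (chi_m3 (Suc n)) / real (Suc n) ^ s"
  let ?o = "\<lambda>n. if odd n then ?c n else 0"
  have "(\<lambda>k. ?o (2 * k + 1)) sums (- (1 / 2 ^ s) * L_real s)"
  proof -
    have "?o (2 * k + 1) = - (1 / 2 ^ s) * ?c k" for k
    proof -
      have "Suc (2 * k + 1) = 2 * Suc k" by simp
      then have "?o (2 * k + 1) = real_of_int (chi_m3 (2 * Suc k)) / real (2 * Suc k) ^ s"
        by (simp only:) simp
      then show ?thesis
        by (simp only: chi_m3_double of_nat_mult power_mult_distrib) (simp del: of_nat_Suc)
    qed
    then show ?thesis
      using sums_mult[OF sums_L_real[OF assms], of "- (1 / 2 ^ s)"] by (simp only:)
  qed
  moreover have "strict_mono (\<lambda>k::nat. 2 * k + 1)" by (rule strict_monoI) simp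
  moreover have "?o n = 0" if "n \<notin> range (\<lambda>k. 2 * k + 1)" for n
    using that by (auto elim!: oddE)
  ultimately have "?o sums (- (1 / 2 ^ s) * L_real s)"
    by (subst (asm) sums_mono_reindex) auto
  then have "(\<lambda>n. ?c n - 2 * ?o n) sums (L_real s - 2 * (- (1 / 2 ^ s) * L_real s))"
    by (intro sums_diff sums_mult sums_L_real assms)
  moreover have "?c n - 2 * ?o n = alt_chi n / real (Suc n) ^ s" for n
    by (auto simp: alt_chi_def)
  ultimately show ?thesis by (simp add: algebra_simps)
qed

lemma integral_ln_power_kern:
  assumes "m \<ge> 1"
  shows "(\<integral>t. ln t ^ m * kern t \<partial>unit_measure) =
    (- 1) ^ m * fact m * (1 + 1 / 2 ^ m) * L_real (Suc m)"
proof -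
  have "(\<lambda>n. alt_chi n / real (Suc n) ^ Suc m) sums
      ((- 1) ^ m / fact m * (\<integral>t. ln t ^ m * kern t \<partial>unit_measure))"
    using assms by (intro sums_integral_power_ln abs_alt_chi_le sums_kern)
  moreover have "(\<lambda>n. alt_chi n / real (Suc n) ^ Suc m) sums ((1 + 2 / 2 ^ Suc m) * L_real (Suc m))"
    using assms by (intro sums_alt_chi) auto
  ultimately have "(- 1) ^ m / fact m * (\<integral>t. ln t ^ m * kern t \<partial>unit_measure) =
      (1 + 1 / 2 ^ m) * L_real (Suc m)"
    using sums_unique2 by fastforce
  then have "(- 1) ^ m * fact m * ((- 1) ^ m / fact m * (\<integral>t. ln t ^ m * kern t \<partial>unit_measure)) =
      (- 1) ^ m * fact m * ((1 + 1 / 2 ^ m) * L_real (Suc m))"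
    by (simp only:)
  then show ?thesis
    by (simp add: mult.assoc)
qed

section \<open>Integrability of products of logarithms, and the summed derivatives\<close>

lemma integrable_log_bound: "integrable unit_measure (\<lambda>t. (1 + \<bar>ln t\<bar> + \<bar>ln (1 - t)\<bar>) ^ m)"
proof (rule Bochner_Integration.integrable_bound)
  have 1: "integrable unit_measure (\<lambda>t. \<bar>ln t\<bar> ^ m)"
    using integrable_abs[OF integrable_power_ln[of 0 m]] by (simp add: power_abs)
  have 0: "integrable unit_measure (\<lambda>t. 1 :: real)"
    using integrable_power_ln[of 0 0] by simp
  show "integrable unit_measure (\<lambda>t. 3 ^ m * (1 + \<bar>ln t\<bar> ^ m + \<bar>ln (1 - t)\<bar> ^ m))"
    using 0 1 integrable_unit_measure_reflect[OF 1] by (intro integrable_mult_right integrable_add) auto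
  have "(1 + \<bar>ln t\<bar> + \<bar>ln (1 - t)\<bar>) ^ m \<le> 3 ^ m * (1 + \<bar>ln t\<bar> ^ m + \<bar>ln (1 - t)\<bar> ^ m)" for t :: real
  proof -
    \<comment> \<open>Replacing each of the three summands by their maximum separates the mixed
      power into pure powers, which are integrable directly or after reflection.\<close>
    let ?M = "max 1 (max \<bar>ln t\<bar> \<bar>ln (1 - t)\<bar>)"
    have "(1 + \<bar>ln t\<bar> + \<bar>ln (1 - t)\<bar>) ^ m \<le> (3 * ?M) ^ m"
      by (intro power_mono) auto
    also have "\<dots> = 3 ^ m * ?M ^ m" by (rule power_mult_distrib)
    also have "?M ^ m \<le> 1 + \<bar>ln t\<bar> ^ m + \<bar>ln (1 - t)\<bar> ^ m"
      by (auto simp: max_def)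
    finally show ?thesis by simp
  qed
  then show "AE t in unit_measure. norm ((1 + \<bar>ln t\<bar> + \<bar>ln (1 - t)\<bar>) ^ m) \<le>
      norm (3 ^ m * (1 + \<bar>ln t\<bar> ^ m + \<bar>ln (1 - t)\<bar> ^ m))"
    by (auto simp: abs_mult)
qed measurable

lemma integrable_ln_ln_kern: "integrable unit_measure (\<lambda>t. ln t ^ i * ln (1 - t) ^ j * kern t)"
proof (rule Bochner_Integration.integrable_bound)
  show "integrable unit_measure (\<lambda>t. 4 / 3 * (1 + \<bar>ln t\<bar> + \<bar>ln (1 - t)\<bar>) ^ (i + j))"
    by (intro integrable_mult_right integrable_log_bound)
  have "\<bar>ln t ^ i * ln (1 - t) ^ j * kern t\<bar> \<le> 4 / 3 * (1 + \<bar>ln t\<bar> + \<bar>ln (1 - t)\<bar>) ^ (i + j)" for t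
  proof -
    have "\<bar>ln t\<bar> ^ i * \<bar>ln (1 - t)\<bar> ^ j * kern t \<le>
        (1 + \<bar>ln t\<bar> + \<bar>ln (1 - t)\<bar>) ^ i * (1 + \<bar>ln t\<bar> + \<bar>ln (1 - t)\<bar>) ^ j * (4 / 3)"
      using kern_le[of t] kern_pos[of t] by (intro mult_mono power_mono) auto
    then show ?thesis
      using kern_pos[of t] by (simp add: abs_mult power_abs power_add)
  qed
  then show "AE t in unit_measure. norm (ln t ^ i * ln (1 - t) ^ j * kern t) \<le>
      norm (4 / 3 * (1 + \<bar>ln t\<bar> + \<bar>ln (1 - t)\<bar>) ^ (i + j))"
    by (intro always_eventually allI) (simp add: abs_mult)
qed measurable

lemma integral_ln_ln_kern_commute:
  "(\<integral>t. ln t ^ i * ln (1 - t) ^ j * kern t \<partial>unit_measure) =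
   (\<integral>t. ln t ^ j * ln (1 - t) ^ i * kern t \<partial>unit_measure)"
  using integral_unit_measure_reflect[of "\<lambda>t. ln t ^ i * ln (1 - t) ^ j * kern t"]
  by (simp add: kern_reflect mult_ac)

text \<open>At x = k + 1 the exponential is w^(k+1) with w = t(1-t); one factor w cancels against
  the weight, and the remaining powers w^k sum to 1/(1-w) = \<open>kern t\<close>.\<close>

lemma sums_higher_deriv_half_Beta:
  fixes f :: "real \<Rightarrow> real"
  assumes f: "\<And>x. x > 0 \<Longrightarrow> f x = (Gamma x)\<^sup>2 / (2 * Gamma (2 * x))"
  shows "(\<lambda>k. (deriv ^^ m) f (real (Suc k))) sums
    (1 / 2 * (\<integral>t. (ln t + ln (1 - t)) ^ m * kern t \<partial>unit_measure))"
proof -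
  let ?w = "\<lambda>t::real. t * (1 - t)"
  let ?f = "\<lambda>k t. 1 / 2 * ln (?w t) ^ m * ?w t ^ k"
  \<comment> \<open>The bound 1/4 is uniform in t, so the integrals of the norms are dominated by a
    geometric series of ratio 1/4.\<close>
  have w_le: "?w t \<le> 1 / 4" for t
  proof -
    have "1 / 4 - ?w t = (t - 1 / 2)\<^sup>2" by (simp add: power2_eq_square algebra_simps)
    then show ?thesis using zero_le_power2[of "t - 1 / 2"] by linarith
  qed
  have eq: "1 / (2 * ?w t) * ln (?w t) ^ m * exp (real (Suc k) * ln (?w t)) = ?f k t"
    if "t \<in> space unit_measure" for t k
  proof -
    have "?w t > 0" using that by auto
    then have "exp (real (Suc k) * ln (?w t)) = ?w t * ?w t ^ k"
      by (simp add: exp_of_nat_mult flip: power_Suc del: of_nat_Suc)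
    moreover have "1 / (2 * z) * l * (z * y) = 1 / 2 * l * y" if "z > 0" for l y z :: real
      using that by simp
    ultimately show ?thesis using \<open>?w t > 0\<close> by (simp only:)
  qed
  have w_nonpos: "ln (?w t) \<le> 0" if "t \<in> space unit_measure" for t
    using that w_le[of t] by (subst ln_le_zero_iff) auto
  have int: "integrable unit_measure (\<lambda>t. 1 / (2 * ?w t) * exp (x * ln (?w t)))" if "x > 0" for x
    using has_bochner_integral_central_Beta[OF that] by (simp add: has_bochner_integral_iff)
  have f_int: "f x = (\<integral>t. 1 / (2 * ?w t) * exp (x * ln (?w t)) \<partial>unit_measure)" if "x > 0" for x
    using has_bochner_integral_central_Beta[OF that] f[OF that] by (simp add: has_bochner_integral_iff)
  have "integrable unit_measure (\<lambda>t. 1 / (2 * ?w t) * ln (?w t) ^ m * exp (real (Suc k) * ln (?w t)))" for k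
    by (rule integrable_log_moment[OF _ _ w_nonpos int]) auto
  then have integrable: "integrable unit_measure (?f k)" for k
    by (subst (asm) Bochner_Integration.integrable_cong[OF refl eq]) auto
  have deriv: "(deriv ^^ m) f (real (Suc k)) = (\<integral>t. ?f k t \<partial>unit_measure)" for k
  proof -
    have "(deriv ^^ m) f (real (Suc k)) =
        (\<integral>t. 1 / (2 * ?w t) * ln (?w t) ^ m * exp (real (Suc k) * ln (?w t)) \<partial>unit_measure)"
      by (rule higher_deriv_log_moment[OF _ _ w_nonpos int f_int]) auto
    also have "\<dots> = (\<integral>t. ?f k t \<partial>unit_measure)"
      by (intro Bochner_Integration.integral_cong refl eq)
    finally show ?thesis .
  qed
  have "(\<lambda>k. \<integral>t. ?f k t \<partial>unit_measure) sums (\<integral>t. (\<Sum>k. ?f k t) \<partial>unit_measure)"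
  proof (rule sums_integral)
    show "AE t in unit_measure. summable (\<lambda>k. norm (?f k t))"
    proof (rule AE_I2)
      fix t assume "t \<in> space unit_measure"
      then have "norm \<bar>?w t\<bar> < 1" using w_le[of t] by auto
      then show "summable (\<lambda>k. norm (?f k t))"
        by (simp only: real_norm_def abs_mult power_abs) (intro summable_mult summable_geometric, simp)
    qed
    show "summable (\<lambda>k. \<integral>t. norm (?f k t) \<partial>unit_measure)"
    proof (rule summable_comparison_test)
      show "summable (\<lambda>k. (1 / 4) ^ k * (\<integral>t. norm (?f 0 t) \<partial>unit_measure))"
        by (intro summable_mult2 summable_geometric) auto
      have "(\<integral>t. norm (?f k t) \<partial>unit_measure) \<le> (\<integral>t. (1 / 4) ^ k * norm (?f 0 t) \<partial>unit_measure)" for k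
      proof (intro integral_mono integrable_norm integrable integrable_mult_right)
        fix t assume "t \<in> space unit_measure"
        then have "0 \<le> ?w t" by auto
        then have "?w t ^ k \<le> (1 / 4) ^ k" using w_le[of t] by (intro power_mono) auto
        then have "norm (?f 0 t) * ?w t ^ k \<le> norm (?f 0 t) * (1 / 4) ^ k"
          by (intro mult_left_mono) auto
        then show "norm (?f k t) \<le> (1 / 4) ^ k * norm (?f 0 t)"
          using \<open>0 \<le> ?w t\<close> by (simp add: abs_mult mult_ac)
      qed
      then show "\<exists>N. \<forall>k\<ge>N. norm (\<integral>t. norm (?f k t) \<partial>unit_measure) \<le>
          (1 / 4) ^ k * (\<integral>t. norm (?f 0 t) \<partial>unit_measure)" by simp
    qed
  qed (rule integrable)
  also have "(\<integral>t. (\<Sum>k. ?f k t) \<partial>unit_measure) =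
      (\<integral>t. 1 / 2 * ((ln t + ln (1 - t)) ^ m * kern t) \<partial>unit_measure)"
  proof (rule Bochner_Integration.integral_cong)
    fix t assume "t \<in> space unit_measure"
    then have t: "0 < t" "0 < 1 - t" by auto
    then have "norm (?w t) < 1" using w_le[of t] by auto
    then have "(\<lambda>k. ?f k t) sums (1 / 2 * ln (?w t) ^ m * (1 / (1 - ?w t)))"
      by (intro sums_mult geometric_sums)
    moreover have "1 - ?w t = 1 - t + t\<^sup>2" by (simp add: power2_eq_square algebra_simps)
    ultimately show "(\<Sum>k. ?f k t) = 1 / 2 * ((ln t + ln (1 - t)) ^ m * kern t)"
      using t by (simp add: sums_iff kern_def ln_mult)
  qed simp
  finally show ?thesis
    unfolding deriv by simp
qed

section \<open>The mean value property\<close>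

text \<open>The primitive sixth root of unity in the upper half plane: a zero of 1 - z + z^2 and the
  fixed point there of z -> 1/(1-z).\<close>

definition rho :: complex where
  "rho = Complex (1 / 2) (sqrt 3 / 2)"

lemma rho_square: "rho * rho = rho - 1"
  by (simp add: rho_def complex_eq_iff)

lemma cnj_rho: "cnj rho = 1 - rho"
  by (simp add: rho_def complex_eq_iff)

lemma exp_pi_third: "exp (\<i> * (of_real pi / 3)) = rho"
proof -
  have "exp (\<i> * of_real (pi / 3)) = rho"
    unfolding cis_conv_exp[symmetric] by (simp add: rho_def complex_eq_iff cos_60 sin_60)
  then show ?thesis by simp
qed

lemma Ln_rho: "Ln rho = \<i> * (of_real pi / 3)"
  using pi_gt_zero by (intro Ln_unique exp_pi_third) auto

lemma Ln_one_minus_rho: "Ln (1 - rho) = - (\<i> * (of_real pi / 3))"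
proof (rule Ln_unique)
  have "exp (- (\<i> * (of_real pi / 3))) * rho = 1"
    using exp_minus_inverse[of "- (\<i> * (of_real pi / 3))"] by (simp only: minus_minus exp_pi_third)
  moreover have "(1 - rho) * rho = 1"
    by (simp add: algebra_simps rho_square)
  moreover have "rho \<noteq> 0" by (simp add: rho_def complex_eq_iff)
  ultimately show "exp (- (\<i> * (of_real pi / 3))) = 1 - rho"
    by (metis mult_cancel_right)
next
  show "- pi < Im (- (\<i> * (of_real pi / 3)))" "Im (- (\<i> * (of_real pi / 3))) \<le> pi"
    using pi_gt_zero by (simp, linarith?)+
qed

text \<open>Sends \<open>\<rho>\<close> to the centre of the disc, and \<open>0, 1, \<infinity>\<close> to the three cube roots of unity.\<close>
definition cayley :: "real \<Rightarrow> complex" where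
  "cayley t = (of_real t - rho) / (of_real t - cnj rho)"

text \<open>Obtained by solving z = (w - rho)/(w - cnj rho) for w; it carries the open unit disc
  into the upper half plane and has its pole at z = 1.\<close>

definition cayley_inv :: "complex \<Rightarrow> complex" where
  "cayley_inv z = (rho - cnj rho * z) / (1 - z)"

lemma of_real_minus_rho_nonzero: "of_real t - rho \<noteq> 0" "of_real t - cnj rho \<noteq> 0"
  by (auto simp: rho_def complex_eq_iff)

lemma norm_cayley [simp]: "norm (cayley t) = 1"
proof -
  have "of_real t - cnj rho = cnj (of_real t - rho)" by simp
  then have "norm (of_real t - cnj rho) = norm (of_real t - rho)"
    by (simp only: complex_mod_cnj)
  then show ?thesis
    using of_real_minus_rho_nonzero[of t] by (simp add: cayley_def norm_divide)
qed

lemma kern_eq_complex: "of_real (kern t) = 1 / ((of_real t - rho) * (of_real t - cnj rho))"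
proof -
  have "(of_real t - rho) * (of_real t - cnj rho) = of_real (1 - t + t\<^sup>2)"
    by (simp add: cnj_rho rho_square algebra_simps power2_eq_square)
  then show ?thesis by (simp add: kern_def)
qed

text \<open>Dividing by \<open>cayley t\<close> gives i sqrt 3 \<open>kern t\<close>: the measure
  \<open>kern t\<close> dt is angular measure on the unit circle up to a constant, so integrals
  against it are circle means.\<close>

lemma cayley_has_vector_derivative:
  "(cayley has_vector_derivative ((rho - cnj rho) * cayley t * of_real (kern t))) (at t within S)"
proof -
  have "((\<lambda>z. (z - rho) / (z - cnj rho)) has_field_derivative
      ((of_real t - cnj rho) - (of_real t - rho)) / ((of_real t - cnj rho) * (of_real t - cnj rho))) (at (of_real t))"
    using of_real_minus_rho_nonzero[of t] by (auto intro!: derivative_eq_intros)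
  also have "((of_real t - cnj rho) - (of_real t - rho)) / ((of_real t - cnj rho) * (of_real t - cnj rho)) =
      (rho - cnj rho) * cayley t * of_real (kern t)"
    using of_real_minus_rho_nonzero[of t] by (simp add: cayley_def kern_eq_complex)
  finally show ?thesis
    unfolding cayley_def by (rule has_vector_derivative_real_field)
qed

lemma continuous_on_cayley [continuous_intros]: "continuous_on S cayley"
  unfolding cayley_def using of_real_minus_rho_nonzero by (intro continuous_intros) auto

lemma continuous_on_kern [continuous_intros]: "continuous_on S kern"
  unfolding kern_def using kern_denom_pos by (intro continuous_intros) (auto simp: less_le)

text \<open>The factor rho - 1 equals e^(2 pi i/3): the unit interval is mapped to an arc of one
  third of the circle whose ends differ by the rotation of order 3.\<close>

lemma cayley_1: "cayley 1 = (rho - 1) * cayley 0"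
proof -
  have "1 - rho \<noteq> 0" "rho \<noteq> 0" by (auto simp: rho_def complex_eq_iff)
  then show ?thesis
    by (simp add: cayley_def cnj_rho divide_simps) (simp add: algebra_simps rho_square)
qed

text \<open>
  The derivative of the integrand in \<open>s\<close> is, up to the factor \<open>s (\<rho> - cnj \<rho>)\<close>, its derivative in \<open>t\<close>, and
  invariance makes the boundary terms at \<open>t = 0\<close> and \<open>t = 1\<close> cancel.
\<close>
lemma cayley_mean_value:
  fixes G :: "complex \<Rightarrow> complex"
  assumes holo: "G holomorphic_on ball 0 1"
    and inv: "\<And>z. norm z < 1 \<Longrightarrow> G ((rho - 1) * z) = G z"
    and r: "0 \<le> r" "r < 1"
  shows "integral {0..1} (\<lambda>t. G (of_real r * cayley t) * of_real (kern t)) =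
    G 0 * of_real (integral {0..1} kern)"
proof -
  define I where "I = (\<lambda>s. integral (cbox 0 1) (\<lambda>t. G (s * cayley t) * of_real (kern t)))"
  define J where "J = (\<lambda>s. integral (cbox 0 1) (\<lambda>t. deriv G (s * cayley t) * cayley t * of_real (kern t)))"
  have contG: "continuous_on (ball 0 1) G"
    using holo by (rule holomorphic_on_imp_continuous_on)
  have contG': "continuous_on (ball 0 1) (deriv G)"
    using holo by (intro holomorphic_on_imp_continuous_on holomorphic_deriv) auto
  have derivG: "(G has_field_derivative deriv G z) (at z)" if "norm z < 1" for z
    using holo that by (intro holomorphic_derivI[where S = "ball 0 1"]) auto
  have deriv: "(I has_field_derivative J s) (at s within ball 0 1)" if "s \<in> ball 0 1" for s
    unfolding I_def J_def
  proof (rule leibniz_rule_field_derivative)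
    fix x :: complex and t' :: real assume x: "x \<in> ball 0 1"
    show "((\<lambda>x. G (x * cayley t') * of_real (kern t')) has_field_derivative
        deriv G (x * cayley t') * cayley t' * of_real (kern t')) (at x within ball 0 1)"
      using x by (auto intro!: derivative_eq_intros DERIV_chain2[OF derivG] simp: norm_mult)
    show "(\<lambda>t. G (x * cayley t) * of_real (kern t)) integrable_on cbox 0 1"
      using x by (intro integrable_continuous continuous_intros continuous_on_compose2[OF contG])
        (auto simp: norm_mult)
  next
    have "continuous_on (ball 0 1 \<times> cbox 0 1)
        (\<lambda>p. deriv G (fst p * cayley (snd p)) * cayley (snd p) * of_real (kern (snd p)))"
      by (intro continuous_intros continuous_on_compose2[OF contG']
            continuous_on_compose2[OF continuous_on_cayley[of UNIV]]
            continuous_on_compose2[OF continuous_on_kern[of UNIV]])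
         (auto simp: norm_mult)
    then show "continuous_on (ball 0 1 \<times> cbox 0 1)
        (\<lambda>(x, t). deriv G (x * cayley t) * cayley t * of_real (kern t))"
      by (simp add: case_prod_beta')
  qed (use that in auto)
  have J0: "J s = 0" if s: "s \<in> ball 0 1" "s \<noteq> 0" for s
  proof -
    have "((\<lambda>t. (s * (rho - cnj rho)) * (deriv G (s * cayley t) * cayley t * of_real (kern t)))
        has_integral G (s * cayley 1) - G (s * cayley 0)) {0..1}"
    proof (rule fundamental_theorem_of_calculus)
      fix t :: real
      have "((G \<circ> (\<lambda>t. s * cayley t)) has_vector_derivative
          (s * ((rho - cnj rho) * cayley t * of_real (kern t))) * deriv G (s * cayley t)) (at t within {0..1})"
        by (intro field_vector_diff_chain_within has_vector_derivative_mult_right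
              cayley_has_vector_derivative has_field_derivative_at_within[OF derivG])
           (use s in \<open>auto simp: norm_mult\<close>)
      then show "((\<lambda>t. G (s * cayley t)) has_vector_derivative
          (s * (rho - cnj rho)) * (deriv G (s * cayley t) * cayley t * of_real (kern t))) (at t within {0..1})"
        by (simp add: o_def mult_ac)
    qed auto
    moreover have "G (s * cayley 1) = G (s * cayley 0)"
      using inv[of "s * cayley 0"] s by (simp add: norm_mult cayley_1 mult.left_commute)
    ultimately have "((\<lambda>t. (s * (rho - cnj rho)) *
        (deriv G (s * cayley t) * cayley t * of_real (kern t))) has_integral 0) {0..1}"
      by simp
    then have "integral {0..1} (\<lambda>t. (s * (rho - cnj rho)) *
        (deriv G (s * cayley t) * cayley t * of_real (kern t))) = 0"
      by (rule integral_unique)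
    then have "(s * (rho - cnj rho)) * J s = 0"
      by (simp add: J_def)
    moreover have "rho - cnj rho \<noteq> 0" by (simp add: rho_def complex_eq_iff)
    ultimately show ?thesis using s by auto
  qed
  \<comment> \<open>The argument for \<open>J0\<close> divides by s, so 0 is left as an exceptional
    point, where continuity of \<open>I\<close> suffices.\<close>
  have "I (of_real r) = I (of_real 0)"
  proof (rule has_derivative_zero_unique_strong_interval[where f = "\<lambda>x. I (of_real x)" and a = 0 and b = r and k = "{0}"])
    show "continuous_on {0..r} (\<lambda>x. I (of_real x))"
    proof (rule continuous_on_compose2[of "ball 0 1" I])
      show "continuous_on (ball 0 1) I"
        using deriv by (intro DERIV_continuous_on)
    qed (use r in \<open>auto intro!: continuous_intros\<close>)
    fix x assume x: "x \<in> {0..r} - {0}"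
    then have "complex_of_real x \<in> ball 0 1" using r by auto
    then have "(I has_field_derivative 0) (at (of_real x))"
      using deriv[of "of_real x"] J0[of "of_real x"] x by (simp add: at_within_open[of _ "ball 0 1"])
    then have "((\<lambda>x. I (of_real x)) has_vector_derivative 0) (at x within {0..r})"
      by (rule has_vector_derivative_real_field)
    then show "((\<lambda>x. I (of_real x)) has_derivative (\<lambda>h. 0)) (at x within {0..r})"
      by (simp add: has_vector_derivative_def)
  qed (use r in auto)
  moreover have "integral {0..1} (\<lambda>t. G 0 * of_real (kern t)) = G 0 * of_real (integral {0..1} kern)"
    using integrable_continuous_interval[OF continuous_on_kern, of 0 1]
    by (simp add: integral_linear[where h = complex_of_real, unfolded o_def] bounded_linear_of_real)
  ultimately show ?thesis
    by (simp add: I_def)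
qed

text \<open>The angle 2 pi/3 of the arc divided by sqrt 3; computed from an arctangent
  antiderivative.\<close>

lemma integral_kern: "integral {0..1} kern = 2 * pi / (3 * sqrt 3)"
proof -
  let ?F = "\<lambda>t. 2 / sqrt 3 * arctan ((2 * t - 1) / sqrt 3)"
  have "(kern has_integral ?F 1 - ?F 0) {0..1}"
  proof (rule fundamental_theorem_of_calculus)
    fix t :: real
    have "1 + ((2 * t - 1) / sqrt 3)\<^sup>2 = 4 / 3 * (1 - t + t\<^sup>2)"
      by (simp add: power_divide power2_eq_square algebra_simps divide_simps)
    moreover have "2 / sqrt 3 * (2 / sqrt 3 / X) = 4 / 3 / X" for X :: real
      by (simp add: divide_simps flip: mult.assoc)
    ultimately have "2 / sqrt 3 * (2 / sqrt 3 / (1 + ((2 * t - 1) / sqrt 3)\<^sup>2)) = kern t"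
      using kern_denom_pos[of t] by (simp only: kern_def) (simp add: divide_simps)
    moreover have "(?F has_real_derivative 2 / sqrt 3 * (2 / sqrt 3 / (1 + ((2 * t - 1) / sqrt 3)\<^sup>2)))
        (at t within {0..1})"
    proof -
      have "((\<lambda>t. (2 * t - 1) / sqrt 3) has_real_derivative 2 / sqrt 3) (at t within {0..1})"
        by (intro DERIV_cdivide) (auto intro!: derivative_eq_intros)
      from DERIV_cmult[OF DERIV_chain2[OF DERIV_arctan this], of "2 / sqrt 3"] show ?thesis
        by (simp add: divide_inverse mult_ac)
    qed
    ultimately show "(?F has_vector_derivative kern t) (at t within {0..1})"
      by (simp add: has_real_derivative_iff_has_vector_derivative)
  qed auto
  then have "integral {0..1} kern = ?F 1 - ?F 0"
    by (rule integral_unique)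
  also have "?F 1 - ?F 0 = 2 / sqrt 3 * (pi / 6) - 2 / sqrt 3 * - (pi / 6)"
  proof -
    have "arctan (1 / sqrt 3) = pi / 6"
      by (rule arctan_unique) (auto simp: tan_30)
    moreover have "(2 * 0 - 1) / sqrt 3 = - (1 / sqrt 3)" "(2 * 1 - 1) / sqrt 3 = 1 / sqrt 3"
      by simp_all
    ultimately show ?thesis
      by (simp only: arctan_minus)
  qed
  also have "\<dots> = 2 * pi / (3 * sqrt 3)"
    by (simp only: diff_conv_add_uminus mult_minus_right minus_minus) (simp add: divide_simps)
  finally show ?thesis .
qed

section \<open>The upper half plane, its order 3 symmetry and the limit to the real line\<close>

lemma Im_cayley_inv_pos:
  assumes "norm z < 1"
  shows "Im (cayley_inv z) > 0"
proof -
  have z1: "1 - z \<noteq> 0" using assms by auto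
  have "(Re z)\<^sup>2 + (Im z)\<^sup>2 < 1"
    using assms by (simp add: cmod_def)
  moreover have "of_real ((norm (1 - z))\<^sup>2) = (1 - z) * cnj (1 - z)"
    by (rule complex_norm_square)
  then have "cayley_inv z = (rho - cnj rho * z) * cnj (1 - z) / of_real ((norm (1 - z))\<^sup>2)"
    using z1 by (simp only: cayley_inv_def) (simp del: complex_cnj_diff)
  \<comment> \<open>After division by |1 - z|^2 this is sqrt 3/2 times the Poisson kernel of the
    disc at the boundary point 1.\<close>
  moreover have "Im ((rho - cnj rho * z) * cnj (1 - z)) = sqrt 3 / 2 * (1 - ((Re z)\<^sup>2 + (Im z)\<^sup>2))"
    by (simp add: rho_def algebra_simps power2_eq_square)
  ultimately have "Im (cayley_inv z) =
      sqrt 3 / 2 * (1 - ((Re z)\<^sup>2 + (Im z)\<^sup>2)) / (norm (1 - z))\<^sup>2" and "(Re z)\<^sup>2 + (Im z)\<^sup>2 < 1"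
    by (simp_all only: Im_divide_of_real)
  then show ?thesis using z1 by simp
qed

text \<open>Conjugates the rotation by a third of a turn about the centre of the disc into the order
  3 map w -> 1/(1-w), which fixes rho.\<close>

lemma cayley_inv_rotate:
  assumes "norm z < 1"
  shows "cayley_inv ((rho - 1) * z) = 1 / (1 - cayley_inv z)"
proof -
  \<comment> \<open>Each vanishing would force |z| = 1, since 1, rho and rho - 1 all have modulus
    1.\<close>
  have nz: "1 - z \<noteq> 0" "1 - (rho - 1) * z \<noteq> 0" "1 - rho - rho * z \<noteq> 0"
  proof -
    show "1 - z \<noteq> 0" using assms by auto
    have r1: "norm (rho - 1) = 1" and r: "norm rho = 1"
      by (simp_all add: rho_def cmod_def power_divide)
    show "1 - (rho - 1) * z \<noteq> 0"
      using assms r1 by (metis eq_iff_diff_eq_0 norm_mult norm_one mult_1 less_irrefl)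
    show "1 - rho - rho * z \<noteq> 0"
      using assms r r1 by (metis eq_iff_diff_eq_0 norm_minus_commute norm_mult mult_1 less_irrefl)
  qed
  have rho_square': "rho * (rho * x) = rho * x - x" for x
    by (simp add: rho_square left_diff_distrib flip: mult.assoc)
  have "1 - cayley_inv z = (1 - rho - rho * z) / (1 - z)"
    using nz by (simp add: cayley_inv_def cnj_rho divide_simps) (simp add: algebra_simps)
  moreover have "cayley_inv ((rho - 1) * z) = (1 - z) / (1 - rho - rho * z)"
    using nz by (simp add: cayley_inv_def cnj_rho divide_simps) (simp add: algebra_simps rho_square rho_square')
  ultimately show ?thesis by simp
qed

lemma cayley_inv_cayley: "cayley_inv (cayley t) = of_real t"
proof -
  have "rho - cnj rho \<noteq> 0" by (simp add: rho_def complex_eq_iff)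
  then show ?thesis
    using of_real_minus_rho_nonzero[of t]
    by (simp add: cayley_inv_def cayley_def divide_simps) (simp add: algebra_simps)
qed

lemma cayley_neq_1: "1 - cayley t \<noteq> 0"
proof
  assume "1 - cayley t = 0"
  then have "of_real t - rho = of_real t - cnj rho"
    using of_real_minus_rho_nonzero[of t] by (simp add: cayley_def divide_simps)
  then show False by (simp add: rho_def complex_eq_iff)
qed

text \<open>
  In this form the imaginary parts bound the numerator below by a multiple of \<open>t\<close> and the denominator by
  a constant, uniformly in \<open>r\<close>; this dominates the logarithms in the limit \<open>r \<rightarrow> 1\<close>.
\<close>
lemma cayley_inv_scaled_eq:
  assumes "0 \<le> r" "r < 1"
  shows "cayley_inv (of_real r * cayley t) =
      Complex ((1 - r) * (t / 2 - 1)) (sqrt 3 / 2 * ((1 + r) * t)) /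
      Complex ((1 - r) * (t - 1 / 2)) (sqrt 3 / 2 * (1 + r))"
proof -
  have "1 - of_real r * cayley t \<noteq> 0"
    using assms by (metis abs_of_nonneg eq_iff_diff_eq_0 less_irrefl mult.right_neutral norm_cayley norm_mult norm_of_real norm_one)
  then have "cayley_inv (of_real r * cayley t) =
      (rho * (of_real t - cnj rho) - cnj rho * of_real r * (of_real t - rho)) /
      ((of_real t - cnj rho) - of_real r * (of_real t - rho))"
    using of_real_minus_rho_nonzero[of t] by (simp add: cayley_inv_def cayley_def divide_simps)
  also have "(of_real t - cnj rho) - of_real r * (of_real t - rho) =
      Complex ((1 - r) * (t - 1 / 2)) (sqrt 3 / 2 * (1 + r))"
    by (simp add: rho_def complex_eq_iff field_simps)
  also have "rho * (of_real t - cnj rho) - cnj rho * of_real r * (of_real t - rho) =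
      Complex ((1 - r) * (t / 2 - 1)) (sqrt 3 / 2 * ((1 + r) * t))"
    by (simp add: rho_def complex_eq_iff field_simps)
  finally show ?thesis .
qed

text \<open>The common shape of the numerators of w and 1 - w and of their denominator. The
  imaginary part alone gives the lower bound, as 1 + r is at least 1; the upper bound 3 adds 1 for
  the real part and 2 for the imaginary part.\<close>

lemma norm_Complex_bounds:
  assumes "0 \<le> r" "r < 1" "\<bar>x\<bar> \<le> 1" "0 \<le> y" "y \<le> 1"
  shows "sqrt 3 / 2 * y \<le> norm (Complex ((1 - r) * x) (sqrt 3 / 2 * ((1 + r) * y)))"
    and "norm (Complex ((1 - r) * x) (sqrt 3 / 2 * ((1 + r) * y))) \<le> 3"
proof -
  let ?z = "Complex ((1 - r) * x) (sqrt 3 / 2 * ((1 + r) * y))"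
  have "1 * y \<le> (1 + r) * y" using assms by (intro mult_right_mono) auto
  then have "sqrt 3 / 2 * y \<le> \<bar>Im ?z\<bar>"
    using assms by simp
  also have "\<dots> \<le> norm ?z" by (rule abs_Im_le_cmod)
  finally show "sqrt 3 / 2 * y \<le> norm ?z" .
  have "sqrt 3 \<le> sqrt 4" by (rule real_sqrt_le_mono) simp
  then have s: "sqrt 3 / 2 \<le> 1" by simp
  have "\<bar>(1 - r) * x\<bar> \<le> 1 * 1"
    unfolding abs_mult using assms by (intro mult_mono) auto
  moreover have "\<bar>sqrt 3 / 2 * ((1 + r) * y)\<bar> \<le> 1 * (2 * 1)"
    unfolding abs_mult using assms s by (intro mult_mono) auto
  ultimately show "norm ?z \<le> 3"
    using cmod_le[of ?z] by simp
qed

lemma norm_cayley_inv_bounds: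
  assumes r: "0 \<le> r" "r < 1" and t: "0 < t" "t < 1"
  defines "w \<equiv> cayley_inv (of_real r * cayley t)"
  shows "t / 4 \<le> norm w" "norm w \<le> 4" "(1 - t) / 4 \<le> norm (1 - w)" "norm (1 - w) \<le> 4"
proof -
  let ?d = "Complex ((1 - r) * (t - 1 / 2)) (sqrt 3 / 2 * ((1 + r) * 1))"
  let ?n = "Complex ((1 - r) * (t / 2 - 1)) (sqrt 3 / 2 * ((1 + r) * t))"
  let ?n' = "Complex ((1 - r) * ((1 + t) / 2)) (sqrt 3 / 2 * ((1 + r) * (1 - t)))"
  have "sqrt (9 / 4) \<le> sqrt 3" by (rule real_sqrt_le_mono) simp
  then have s: "3 / 4 \<le> sqrt 3 / 2" by (simp add: real_sqrt_divide)
  have "\<bar>t - 1 / 2\<bar> \<le> 1" using t by linarith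
  then have "sqrt 3 / 2 * 1 \<le> norm ?d" and d: "norm ?d \<le> 3"
    by (intro norm_Complex_bounds[OF r]; simp)+
  then have "3 / 4 \<le> norm ?d" using s by linarith
  note d = this d
  \<comment> \<open>The denominator lies between 3/4 and 3, the numerator between 3y/4 and 3, whence
    the constants 1/4 and 4. It is used with y = t for w and y = 1 - t for 1 - w.\<close>
  have quot: "y / 4 \<le> norm (n / ?d) \<and> norm (n / ?d) \<le> 4"
    if n: "sqrt 3 / 2 * y \<le> norm n" "norm n \<le> 3" and "0 < y" for n y
  proof -
    have "3 / 4 * y \<le> sqrt 3 / 2 * y" using \<open>0 < y\<close> s by (intro mult_right_mono) auto
    moreover have "y / 4 * norm ?d \<le> y / 4 * 3" using \<open>0 < y\<close> d by (intro mult_left_mono) auto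
    ultimately have "y / 4 * norm ?d \<le> norm n" "norm n \<le> 4 * norm ?d"
      using n d by linarith+
    moreover have "0 < norm ?d" using d by linarith
    ultimately show ?thesis
      by (simp only: norm_divide pos_le_divide_eq pos_divide_le_eq)
  qed
  have w: "w = ?n / ?d"
    unfolding w_def using cayley_inv_scaled_eq[OF r] by simp
  have "?d \<noteq> 0" using d by auto
  then have w': "1 - w = ?n' / ?d"
    unfolding w by (simp add: divide_simps) (simp add: complex_eq_iff field_simps)
  show "t / 4 \<le> norm w" "norm w \<le> 4"
    unfolding w using quot[of t ?n] norm_Complex_bounds[OF r, of "t / 2 - 1" t] t by auto
  show "(1 - t) / 4 \<le> norm (1 - w)" "norm (1 - w) \<le> 4"
    unfolding w' using quot[of "1 - t" ?n'] norm_Complex_bounds[OF r, of "(1 + t) / 2" "1 - t"] t by auto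
qed

text \<open>The real part ln |w| is at most ln 4 + |ln y| in modulus with ln 4 <= 3, and the
  imaginary part at most pi < 4.\<close>

lemma norm_Ln_le:
  assumes "y / 4 \<le> norm w" "norm w \<le> 4" "0 < y" "y < 1"
  shows "norm (Ln w) \<le> 8 * (1 + \<bar>ln y\<bar>)"
proof -
  have "w \<noteq> 0" using assms by auto
  have "ln y < 0" using assms by simp
  have "ln (y / 4) = ln y - ln 4" using assms by (simp add: ln_div)
  have "ln (y / 4) \<le> ln (norm w)" "ln (norm w) \<le> ln 4"
    using assms by (auto simp: ln_le_cancel_iff intro!: ln_mono)
  then have "\<bar>ln (norm w)\<bar> \<le> ln 4 + \<bar>ln y\<bar>"
    using \<open>ln y < 0\<close> \<open>ln (y / 4) = ln y - ln 4\<close> by linarith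
  moreover have "ln 4 \<le> (3 :: real)"
    using ln_le_minus_one[of "4::real"] by simp
  moreover have "norm (Ln w) \<le> \<bar>Re (Ln w)\<bar> + \<bar>Im (Ln w)\<bar>" by (rule cmod_le)
  moreover have "\<bar>Im (Ln w)\<bar> \<le> pi"
    using mpi_less_Im_Ln[OF \<open>w \<noteq> 0\<close>] Im_Ln_le_pi[OF \<open>w \<noteq> 0\<close>] by linarith
  ultimately have "norm (Ln w) \<le> 7 + \<bar>ln y\<bar>"
    using \<open>w \<noteq> 0\<close> pi_less_4 by simp
  also have "\<dots> \<le> 8 * (1 + \<bar>ln y\<bar>)" by simp
  finally show ?thesis .
qed

text \<open>For w in the upper half plane, arg w lies in (0, pi) and arg (1-w) in (-pi, 0). Since 1
  - 1/(1-w) = -w/(1-w), subtracting pi i brings the argument back into (-pi, pi), so the principal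
  branch is hit.\<close>

lemma Ln_rotate:
  assumes "Im w > 0"
  shows "Ln (1 / (1 - w)) = - Ln (1 - w)"
    and "Ln (1 - 1 / (1 - w)) = Ln w - Ln (1 - w) - \<i> * of_real pi"
proof -
  have "1 - w \<noteq> 0" "w \<noteq> 0" using assms by (auto simp: complex_eq_iff)
  have "1 - w \<notin> \<real>\<^sub>\<le>\<^sub>0" using assms by (auto simp: complex_nonpos_Reals_iff)
  then show "Ln (1 / (1 - w)) = - Ln (1 - w)"
    using Ln_inverse[of "1 - w"] by (simp add: inverse_eq_divide)
  have Imw: "0 < Im (Ln w)" "Im (Ln w) < pi"
    using Im_Ln_pos_lt_imp[OF assms] by auto
  have Imw': "- pi < Im (Ln (1 - w))" "Im (Ln (1 - w)) < 0"
    using mpi_less_Im_Ln[OF \<open>1 - w \<noteq> 0\<close>] Im_Ln_le_pi[OF \<open>1 - w \<noteq> 0\<close>]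
      Im_Ln_pos_le[OF \<open>1 - w \<noteq> 0\<close>] assms by auto
  show "Ln (1 - 1 / (1 - w)) = Ln w - Ln (1 - w) - \<i> * of_real pi"
  proof (rule Ln_unique)
    have "exp (Ln w - Ln (1 - w) - \<i> * of_real pi) = w / (1 - w) / exp (\<i> * of_real pi)"
      using \<open>1 - w \<noteq> 0\<close> \<open>w \<noteq> 0\<close> by (simp add: exp_diff)
    also have "\<dots> = 1 - 1 / (1 - w)"
      using \<open>1 - w \<noteq> 0\<close> by (simp add: divide_simps)
    finally show "exp (Ln w - Ln (1 - w) - \<i> * of_real pi) = 1 - 1 / (1 - w)" .
  qed (use Imw Imw' in auto)
qed

text \<open>
  The three summands are \<open>a\<^sup>i b\<^sup>j\<close> at \<open>w\<close>, \<open>1/(1-w)\<close> and \<open>1-1/w\<close>, with the branches of the logarithms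
  continued from the upper half plane; see \<open>Ln_rotate\<close>.
\<close>
definition fold3 :: "nat \<Rightarrow> nat \<Rightarrow> complex \<Rightarrow> complex \<Rightarrow> complex" where
  "fold3 i j a b = a ^ i * b ^ j + (- b) ^ i * (a - b - \<i> * of_real pi) ^ j +
     (b - a + \<i> * of_real pi) ^ i * (- a) ^ j"

text \<open>The substitution permutes the three summands cyclically; with \<open>Ln_rotate\<close>
  this is the invariance under w -> 1/(1-w).\<close>

lemma fold3_rotate: "fold3 i j (- b) (a - b - \<i> * of_real pi) = fold3 i j a b"
  by (simp add: fold3_def algebra_simps)

text \<open>Every base of a power in \<open>fold3\<close> is bounded by 4(1 + |a| + |b|), the 4
  absorbing pi.\<close>

lemma norm_fold3_le: "norm (fold3 i j a b) \<le> 3 * (4 * (1 + norm a + norm b)) ^ (i + j)"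
proof -
  let ?B = "4 * (1 + norm a + norm b)"
  have *: "norm (x ^ i * y ^ j) \<le> ?B ^ (i + j)" if "norm x \<le> ?B" "norm y \<le> ?B" for x y :: complex
  proof -
    have "norm (x ^ i * y ^ j) = norm x ^ i * norm y ^ j" by (simp add: norm_mult norm_power)
    also have "\<dots> \<le> ?B ^ i * ?B ^ j" using that by (intro mult_mono power_mono) auto
    finally show ?thesis by (simp add: power_add)
  qed
  have ab: "norm a \<le> ?B" "norm b \<le> ?B" by (simp_all add: algebra_simps)
  have "norm (\<i> * complex_of_real pi) \<le> 4" using pi_less_4 by (simp add: norm_mult)
  then have "norm (a - b - \<i> * of_real pi) \<le> norm a + norm b + 4"
    using norm_triangle_ineq4[of "a - b" "\<i> * of_real pi"] norm_triangle_ineq4[of a b] by linarith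
  moreover have "x + y + 4 \<le> 4 * (1 + x + y)" if "0 \<le> x" "0 \<le> y" for x y :: real
    using that by simp
  ultimately have c: "norm (a - b - \<i> * of_real pi) \<le> ?B"
    by (meson norm_ge_zero order_trans)
  moreover have "norm (b - a + \<i> * of_real pi) = norm (a - b - \<i> * of_real pi)"
    by (metis (no_types, opaque_lifting) diff_diff_eq2 minus_diff_eq norm_minus_cancel add.commute diff_add_eq)
  ultimately have d: "norm (b - a + \<i> * of_real pi) \<le> ?B" by simp
  have "norm (fold3 i j a b) \<le> ?B ^ (i + j) + ?B ^ (i + j) + ?B ^ (i + j)"
    unfolding fold3_def
    by (rule order_trans[OF norm_triangle_ineq] add_mono)+ (rule *; use ab c d in \<open>simp only: norm_minus_cancel\<close>)+
  then show ?thesis by simp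
qed

lemma integrable_unit_measure_continuous:
  fixes f :: "real \<Rightarrow> complex"
  assumes "continuous_on {0..1} f"
  shows "integrable unit_measure f"
proof -
  have "set_integrable lborel {0..1} f"
    using assms by (rule borel_integrable_atLeastAtMost')
  then have "set_integrable lborel {0<..<1} f"
    by (rule set_integrable_subset) auto
  then show ?thesis
    by (simp add: unit_measure_def integrable_restrict_space set_integrable_def)
qed

text \<open>The mean value property holds on each smaller circle of radius r < 1, with a value
  independent of r. Letting r = n/(n+1) tend to 1 under a dominating function gives both
  integrability and the value on the boundary, the value being that of \<open>fold3\<close> at Ln
  rho and Ln (1 - rho).\<close>

lemma fold3_integral:
  fixes i j :: nat
  defines "F \<equiv> \<lambda>t. fold3 i j (of_real (ln t)) (of_real (ln (1 - t))) * of_real (kern t)"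
  shows "integrable unit_measure F" (is ?int)
    and "(\<integral>t. F t \<partial>unit_measure) =
      fold3 i j (\<i> * (of_real pi / 3)) (- (\<i> * (of_real pi / 3))) * of_real (2 * pi / (3 * sqrt 3))" (is ?eq)
proof -
  define G where "G = (\<lambda>z. fold3 i j (Ln (cayley_inv z)) (Ln (1 - cayley_inv z)))"
  define r where "r = (\<lambda>n. real n / real (Suc n))"
  have r: "0 \<le> r n" "r n < 1" for n by (auto simp: r_def)
  have r_lim: "r \<longlonglongrightarrow> 1" unfolding r_def by (rule LIMSEQ_n_over_Suc_n)
  have nonneg: "cayley_inv z \<notin> \<real>\<^sub>\<le>\<^sub>0" "1 - cayley_inv z \<notin> \<real>\<^sub>\<le>\<^sub>0" if "norm z < 1" for z
    using Im_cayley_inv_pos[OF that] by (auto simp: complex_nonpos_Reals_iff)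
  have "cayley_inv holomorphic_on ball 0 1"
    unfolding cayley_inv_def by (intro holomorphic_intros) auto
  then have holo: "G holomorphic_on ball 0 1"
    unfolding G_def fold3_def using nonneg by (intro holomorphic_intros) auto
  have inv: "G ((rho - 1) * z) = G z" if "norm z < 1" for z
    using that by (simp add: G_def cayley_inv_rotate Ln_rotate Im_cayley_inv_pos fold3_rotate)
  have contG: "continuous_on {0..1} (\<lambda>t. G (of_real (r n) * cayley t) * of_real (kern t))" for n
    using r[of n]
    by (intro continuous_intros continuous_on_compose2[OF holomorphic_on_imp_continuous_on[OF holo]])
       (auto simp: norm_mult)
  have eq: "(\<integral>t. G (of_real (r n) * cayley t) * of_real (kern t) \<partial>unit_measure) =
      fold3 i j (\<i> * (of_real pi / 3)) (- (\<i> * (of_real pi / 3))) * of_real (2 * pi / (3 * sqrt 3))" for n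
  proof -
    have "cayley_inv 0 = rho" by (simp add: cayley_inv_def)
    then have "G 0 = fold3 i j (\<i> * (of_real pi / 3)) (- (\<i> * (of_real pi / 3)))"
      by (simp only: G_def Ln_rho Ln_one_minus_rho)
    then show ?thesis
      using cayley_mean_value[OF holo inv r, of n]
      by (simp only: integral_unit_measure_eq_integral[OF integrable_unit_measure_continuous[OF contG]]
            integral_kern)
  qed
  \<comment> \<open>The 3 counts the summands of \<open>fold3\<close>, 4/3 bounds the kernel, and 68
    = 4(1 + 8 + 8) combines \<open>norm_fold3_le\<close> with two uses of
    \<open>norm_Ln_le\<close>.\<close>
  let ?D = "\<lambda>t. 3 * 68 ^ (i + j) * (4 / 3) * (1 + \<bar>ln t\<bar> + \<bar>ln (1 - t)\<bar>) ^ (i + j)"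
  let ?s = "\<lambda>n t. G (of_real (r n) * cayley t) * of_real (kern t)"
  have D: "integrable unit_measure ?D"
    by (intro integrable_mult_right integrable_log_bound)
  have F_meas: "F \<in> borel_measurable unit_measure"
    unfolding F_def fold3_def by measurable
  have s_meas: "?s n \<in> borel_measurable unit_measure" for n
    using integrable_unit_measure_continuous[OF contG] by (rule borel_measurable_integrable)
  have lim: "AE t in unit_measure. (\<lambda>n. ?s n t) \<longlonglongrightarrow> F t"
  proof (rule AE_I2)
    fix t assume "t \<in> space unit_measure"
    then have t: "0 < t" "t < 1" by auto
    have "(\<lambda>n. cayley_inv (of_real (r n) * cayley t)) \<longlonglongrightarrow> cayley_inv (of_real 1 * cayley t)"
      unfolding cayley_inv_def using cayley_neq_1[of t] by (intro tendsto_intros r_lim) auto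
    then have T: "(\<lambda>n. cayley_inv (of_real (r n) * cayley t)) \<longlonglongrightarrow> of_real t"
      by (simp add: cayley_inv_cayley)
    \<comment> \<open>Both limit points avoid the branch cut, so \<open>Ln\<close> is continuous
      there.\<close>
    have "complex_of_real t \<notin> \<real>\<^sub>\<le>\<^sub>0" "1 - complex_of_real t \<notin> \<real>\<^sub>\<le>\<^sub>0"
      using t by (auto simp: complex_nonpos_Reals_iff)
    then have "(\<lambda>n. ?s n t) \<longlonglongrightarrow> fold3 i j (Ln (of_real t)) (Ln (1 - of_real t)) * of_real (kern t)"
      unfolding G_def fold3_def by (intro tendsto_intros T)
    moreover have "Ln (of_real t) = of_real (ln t)" "Ln (1 - of_real t) = of_real (ln (1 - t))"
      using t Ln_of_real[of t] Ln_of_real[of "1 - t"] by auto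
    ultimately show "(\<lambda>n. ?s n t) \<longlonglongrightarrow> F t"
      by (simp add: F_def)
  qed
  have bound: "AE t in unit_measure. norm (?s n t) \<le> ?D t" for n
  proof (rule AE_I2)
    fix t assume "t \<in> space unit_measure"
    then have t: "0 < t" "t < 1" by auto
    let ?w = "cayley_inv (of_real (r n) * cayley t)"
    note b = norm_cayley_inv_bounds[OF r[of n] t]
    have "norm (Ln ?w) \<le> 8 * (1 + \<bar>ln t\<bar>)" "norm (Ln (1 - ?w)) \<le> 8 * (1 + \<bar>ln (1 - t)\<bar>)"
      using norm_Ln_le[OF b(1,2) t] norm_Ln_le[OF b(3,4)] t by simp_all
    then have "4 * (1 + norm (Ln ?w) + norm (Ln (1 - ?w))) \<le> 68 * (1 + \<bar>ln t\<bar> + \<bar>ln (1 - t)\<bar>)"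
      by simp
    then have "(4 * (1 + norm (Ln ?w) + norm (Ln (1 - ?w)))) ^ (i + j) \<le>
        (68 * (1 + \<bar>ln t\<bar> + \<bar>ln (1 - t)\<bar>)) ^ (i + j)"
      by (intro power_mono) auto
    then have "norm (G (of_real (r n) * cayley t)) \<le> 3 * (68 * (1 + \<bar>ln t\<bar> + \<bar>ln (1 - t)\<bar>)) ^ (i + j)"
      unfolding G_def using norm_fold3_le[of i j "Ln ?w" "Ln (1 - ?w)"] by linarith
    then have "norm (G (of_real (r n) * cayley t)) * kern t \<le>
        3 * (68 * (1 + \<bar>ln t\<bar> + \<bar>ln (1 - t)\<bar>)) ^ (i + j) * (4 / 3)"
      using kern_le[of t] kern_pos[of t] by (intro mult_mono) auto
    also have "\<dots> = ?D t" unfolding power_mult_distrib by simp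
    finally show "norm (?s n t) \<le> ?D t"
      using kern_pos[of t] by (simp add: norm_mult)
  qed
  show ?int
    by (rule integrable_dominated_convergence[OF F_meas s_meas D lim bound])
  have "(\<lambda>n. \<integral>t. ?s n t \<partial>unit_measure) \<longlonglongrightarrow> (\<integral>t. F t \<partial>unit_measure)"
    by (rule integral_dominated_convergence[OF F_meas s_meas D lim bound])
  then show ?eq
    unfolding eq using LIMSEQ_unique tendsto_const by blast
qed

section \<open>The value at 3\<close>

text \<open>Differentiates an identity valid on an open set; it drives the reflection formulas
  below.\<close>

lemma DERIV_eq_on_open:
  fixes f g :: "real \<Rightarrow> real"
  assumes "(f has_field_derivative f') (at x)" "(g has_field_derivative g') (at x)"
    and "open S" "x \<in> S" "\<And>y. y \<in> S \<Longrightarrow> f y = g y"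
  shows "f' = g'"
proof -
  have "(g has_field_derivative f') (at x)"
    using assms(1,3,4,5) by (rule has_field_derivative_transform_within_open)
  then show ?thesis using assms(2) by (rule DERIV_unique)
qed

lemma Gamma_reflection_real:
  fixes x :: real
  shows "Gamma x * Gamma (1 - x) = pi / sin (pi * x)"
proof -
  have "sin (complex_of_real pi * of_real x) = of_real (sin (pi * x))"
    by (metis of_real_mult sin_of_real)
  then have "complex_of_real (Gamma x * Gamma (1 - x)) = complex_of_real (pi / sin (pi * x))"
    using Gamma_reflection_complex[of "of_real x"]
    by (simp flip: Gamma_complex_of_real)
  then show ?thesis by (simp only: of_real_eq_iff)
qed

lemma sin_pi_mult_pos: "0 < x \<Longrightarrow> x < 1 \<Longrightarrow> sin (pi * x) > 0"
  by (intro sin_gt_zero) auto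

lemma not_nonpos_Int: "(x :: real) > 0 \<Longrightarrow> x \<notin> \<int>\<^sub>\<le>\<^sub>0"
  by (auto elim!: nonpos_Ints_cases)

text \<open>The logarithmic derivative of Euler's reflection formula, taken on (0,1) where all
  factors are positive; \<open>trigamma_reflection\<close> and \<open>tetragamma_reflection\<close>
  differentiate it further.\<close>

lemma Digamma_reflection:
  fixes x :: real
  assumes "0 < x" "x < 1"
  shows "Digamma x - Digamma (1 - x) = - pi * cos (pi * x) / sin (pi * x)"
proof (rule DERIV_eq_on_open[where S = "{0<..<1}"])
  show "((\<lambda>x. ln_Gamma x + ln_Gamma (1 - x)) has_field_derivative Digamma x - Digamma (1 - x)) (at x)"
    using assms by (auto intro!: derivative_eq_intros)
  show "((\<lambda>x. ln pi - ln (sin (pi * x))) has_field_derivative - pi * cos (pi * x) / sin (pi * x)) (at x)"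
    using sin_pi_mult_pos[OF assms] by (auto intro!: derivative_eq_intros)
  fix y :: real assume "y \<in> {0<..<1}"
  then have y: "0 < y" "y < 1" by auto
  then have "Gamma y > 0" "Gamma (1 - y) > 0"
    by (auto intro: Gamma_real_pos)
  then have "ln (Gamma y) + ln (Gamma (1 - y)) = ln (Gamma y * Gamma (1 - y))"
    by (simp add: ln_mult)
  then show "ln_Gamma y + ln_Gamma (1 - y) = ln pi - ln (sin (pi * y))"
    using y sin_pi_mult_pos[OF y] by (simp add: ln_Gamma_real_pos Gamma_reflection_real ln_div)
qed (use assms in auto)

lemma trigamma_reflection:
  fixes x :: real
  assumes "0 < x" "x < 1"
  shows "Polygamma 1 x + Polygamma 1 (1 - x) = pi\<^sup>2 / (sin (pi * x))\<^sup>2"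
proof (rule DERIV_eq_on_open[where S = "{0<..<1}"])
  show "((\<lambda>x. Digamma x - Digamma (1 - x)) has_field_derivative Polygamma 1 x + Polygamma 1 (1 - x)) (at x)"
    using assms not_nonpos_Int[of x] not_nonpos_Int[of "1 - x"] by (auto intro!: derivative_eq_intros)
  let ?s = "sin (pi * x)" and ?c = "cos (pi * x)"
  have "((\<lambda>x. - pi * cos (pi * x) / sin (pi * x)) has_field_derivative
      ((- pi * (- ?s * pi)) * ?s - (- pi * ?c) * (?c * pi)) / (?s * ?s)) (at x)"
    using sin_pi_mult_pos[OF assms] by (intro DERIV_divide) (auto intro!: derivative_eq_intros)
  moreover have "(- pi * (- s * pi)) * s - (- pi * c) * (c * pi) = pi\<^sup>2 * (s\<^sup>2 + c\<^sup>2)" for s c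
    by (simp add: power2_eq_square algebra_simps)
  ultimately show "((\<lambda>x. - pi * cos (pi * x) / sin (pi * x)) has_field_derivative pi\<^sup>2 / ?s\<^sup>2) (at x)"
    by (simp flip: power2_eq_square)
qed (use assms in \<open>auto simp: Digamma_reflection\<close>)

lemma tetragamma_reflection:
  fixes x :: real
  assumes "0 < x" "x < 1"
  shows "Polygamma 2 x - Polygamma 2 (1 - x) = - 2 * pi ^ 3 * cos (pi * x) / sin (pi * x) ^ 3"
proof (rule DERIV_eq_on_open[where S = "{0<..<1}"])
  show "((\<lambda>x. Polygamma 1 x + Polygamma 1 (1 - x)) has_field_derivative Polygamma 2 x - Polygamma 2 (1 - x)) (at x)"
    using assms not_nonpos_Int[of x] not_nonpos_Int[of "1 - x"]
    by (auto intro!: derivative_eq_intros simp: numeral_2_eq_2)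
  show "((\<lambda>x. pi\<^sup>2 / (sin (pi * x))\<^sup>2) has_field_derivative - 2 * pi ^ 3 * cos (pi * x) / sin (pi * x) ^ 3) (at x)"
    using sin_pi_mult_pos[OF assms]
    by (auto intro!: derivative_eq_intros simp: divide_simps power2_eq_square power3_eq_cube)
qed (use assms in \<open>auto simp: trigamma_reflection[unfolded One_nat_def]\<close>)

text \<open>Grouping by residues mod 3 writes the series as a difference of two tetragamma series at
  1/3 and 2/3 = 1 - 1/3, which the reflection formula evaluates.\<close>

lemma L_real_3: "L_real 3 = 4 * pi ^ 3 / (81 * sqrt 3)"
proof -
  let ?c = "\<lambda>n. real_of_int (chi_m3 (Suc n)) / real (Suc n) ^ 3"
  \<comment> \<open>Block n covers the integers 3n+1, 3n+2, 3n+3, with characters 1, -1, 0;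
    factoring out 3^3 gives 1/27.\<close>
  have "(\<lambda>n. sum ?c {n * 3..<n * 3 + 3}) sums L_real 3"
    by (intro sums_group sums_L_real) auto
  moreover have "sum ?c {n * 3..<n * 3 + 3} =
      1 / 27 * (inverse ((1 / 3 + of_nat n) ^ Suc 2) - inverse ((2 / 3 + of_nat n) ^ Suc 2))" for n
  proof -
    have "{n * 3..<n * 3 + 3} = {n * 3, n * 3 + 1, n * 3 + 2}" by auto
    moreover have "chi_m3 (Suc (n * 3)) = 1" "chi_m3 (Suc (n * 3 + 1)) = - 1" "chi_m3 (Suc (n * 3 + 2)) = 0"
      by (simp_all add: chi_m3_def mod_Suc)
    moreover have "1 / 27 * inverse ((1 / 3 + real n) ^ Suc 2) = 1 / real (Suc (n * 3)) ^ 3"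
      "1 / 27 * inverse ((2 / 3 + real n) ^ Suc 2) = 1 / real (Suc (n * 3 + 1)) ^ 3"
    proof -
      have *: "1 / 27 * inverse (y ^ Suc 2) = 1 / (3 * y) ^ 3" for y :: real
        by (simp add: power_mult_distrib power3_eq_cube power2_eq_square divide_simps)
      have **: "3 * (1 / 3 + real n) = real (Suc (n * 3))" "3 * (2 / 3 + real n) = real (Suc (n * 3 + 1))"
        by simp_all
      show "1 / 27 * inverse ((1 / 3 + real n) ^ Suc 2) = 1 / real (Suc (n * 3)) ^ 3"
        "1 / 27 * inverse ((2 / 3 + real n) ^ Suc 2) = 1 / real (Suc (n * 3 + 1)) ^ 3"
        unfolding * ** by (rule refl)+
    qed
    ultimately show ?thesis
      unfolding right_diff_distrib by (simp del: of_nat_Suc power_Suc)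
  qed
  moreover have "(\<lambda>n. 1 / 27 * (inverse ((1 / 3 + of_nat n) ^ Suc 2) - inverse ((2 / 3 + of_nat n) ^ Suc 2))) sums
      (1 / 27 * ((- 1) ^ Suc 2 * Polygamma 2 (1 / 3 :: real) / fact 2 - (- 1) ^ Suc 2 * Polygamma 2 (2 / 3) / fact 2))"
    by (intro sums_mult sums_diff Polygamma_LIMSEQ) auto
  ultimately have "L_real 3 = 1 / 27 * ((- 1) ^ Suc 2 * Polygamma 2 (1 / 3 :: real) / fact 2
      - (- 1) ^ Suc 2 * Polygamma 2 (2 / 3) / fact 2)"
    by (simp only: sums_iff)
  also have "\<dots> = - (1 / 54) * (Polygamma 2 (1 / 3) - Polygamma 2 (1 - 1 / 3))"
    by (simp add: fact_2 algebra_simps)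
  also have "\<dots> = - (1 / 54) * (- 2 * pi ^ 3 * cos (pi / 3) / sin (pi / 3) ^ 3)"
    by (subst tetragamma_reflection) auto
  also have "\<dots> = 4 * pi ^ 3 / (81 * sqrt 3)"
    by (simp add: cos_60 sin_60 power_divide power3_eq_cube divide_simps)
  finally show ?thesis .
qed

section \<open>Mixed moments\<close>

text \<open>For real a, b the real part of \<open>fold3 1 1 a b\<close> is a^2 + b^2 - ab. At rho
  all three summands coincide, with sum 3 (pi/3)^2, and the total mass of the kernel is 2 pi/(3 sqrt
  3).\<close>

lemma integral_ln_ln_kern_1_1:
  "(\<integral>t. ln t * ln (1 - t) * kern t \<partial>unit_measure) =
     2 * (\<integral>t. ln t ^ 2 * kern t \<partial>unit_measure) - 2 * pi ^ 3 / (9 * sqrt 3)"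
proof -
  let ?F = "\<lambda>t. fold3 1 1 (of_real (ln t)) (of_real (ln (1 - t))) * of_real (kern t)"
  note int = integrable_ln_ln_kern
  have "Re (\<integral>t. ?F t \<partial>unit_measure) = (\<integral>t. Re (?F t) \<partial>unit_measure)"
    using fold3_integral(1) by (intro integral_Re[symmetric])
  also have "\<dots> = (\<integral>t. ln t ^ 2 * ln (1 - t) ^ 0 * kern t + ln t ^ 0 * ln (1 - t) ^ 2 * kern t -
      ln t ^ 1 * ln (1 - t) ^ 1 * kern t \<partial>unit_measure)"
    by (intro Bochner_Integration.integral_cong refl) (simp add: fold3_def power2_eq_square algebra_simps)
  also have "\<dots> = (\<integral>t. ln t ^ 2 * ln (1 - t) ^ 0 * kern t \<partial>unit_measure) +
      (\<integral>t. ln t ^ 0 * ln (1 - t) ^ 2 * kern t \<partial>unit_measure) -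
      (\<integral>t. ln t ^ 1 * ln (1 - t) ^ 1 * kern t \<partial>unit_measure)"
    by (simp only: Bochner_Integration.integral_diff[OF Bochner_Integration.integrable_add[OF int int] int]
          Bochner_Integration.integral_add[OF int int])
  also have "(\<integral>t. ln t ^ 0 * ln (1 - t) ^ 2 * kern t \<partial>unit_measure) =
      (\<integral>t. ln t ^ 2 * ln (1 - t) ^ 0 * kern t \<partial>unit_measure)"
    by (rule integral_ln_ln_kern_commute)
  finally have "Re (\<integral>t. ?F t \<partial>unit_measure) = 2 * (\<integral>t. ln t ^ 2 * kern t \<partial>unit_measure) -
      (\<integral>t. ln t * ln (1 - t) * kern t \<partial>unit_measure)" by simp
  moreover have "Re (\<integral>t. ?F t \<partial>unit_measure) = 2 * pi ^ 3 / (9 * sqrt 3)"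
    unfolding fold3_integral(2) by (simp add: fold3_def power2_eq_square power3_eq_cube algebra_simps)
  ultimately show ?thesis by simp
qed

text \<open>For real a, b the real part of \<open>fold3 2 1 a b\<close> is 3a^2 b + pi^2 a - a^3 -
  b^3; the pi^2 comes from squaring the branch shift. The value at rho is purely imaginary, so the
  mean of this real part is 0.\<close>

lemma integral_ln_ln_kern_2_1:
  "3 * (\<integral>t. ln t ^ 2 * ln (1 - t) * kern t \<partial>unit_measure) =
     2 * (\<integral>t. ln t ^ 3 * kern t \<partial>unit_measure) - pi\<^sup>2 * (\<integral>t. ln t * kern t \<partial>unit_measure)"
proof -
  let ?F = "\<lambda>t. fold3 2 1 (of_real (ln t)) (of_real (ln (1 - t))) * of_real (kern t)"
  let ?A = "\<lambda>i j t. ln t ^ i * ln (1 - t) ^ j * kern t"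
  note int = integrable_ln_ln_kern
  have "Re (\<integral>t. ?F t \<partial>unit_measure) = (\<integral>t. Re (?F t) \<partial>unit_measure)"
    using fold3_integral(1) by (intro integral_Re[symmetric])
  also have "\<dots> = (\<integral>t. (3 * ?A 2 1 t + pi\<^sup>2 * ?A 1 0 t) - (?A 3 0 t + ?A 0 3 t) \<partial>unit_measure)"
    by (intro Bochner_Integration.integral_cong refl)
       (simp add: fold3_def power2_eq_square power3_eq_cube algebra_simps)
  also have "\<dots> = (\<integral>t. 3 * ?A 2 1 t + pi\<^sup>2 * ?A 1 0 t \<partial>unit_measure) -
      (\<integral>t. ?A 3 0 t + ?A 0 3 t \<partial>unit_measure)"
    by (intro Bochner_Integration.integral_diff Bochner_Integration.integrable_add integrable_mult_right int)
  also have "(\<integral>t. 3 * ?A 2 1 t + pi\<^sup>2 * ?A 1 0 t \<partial>unit_measure) =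
      3 * (\<integral>t. ?A 2 1 t \<partial>unit_measure) + pi\<^sup>2 * (\<integral>t. ?A 1 0 t \<partial>unit_measure)"
    by (subst Bochner_Integration.integral_add) (intro integrable_mult_right int | simp only: integral_mult_right_zero)+
  also have "(\<integral>t. ?A 3 0 t + ?A 0 3 t \<partial>unit_measure) =
      (\<integral>t. ?A 3 0 t \<partial>unit_measure) + (\<integral>t. ?A 0 3 t \<partial>unit_measure)"
    by (intro Bochner_Integration.integral_add int)
  also have "(\<integral>t. ?A 0 3 t \<partial>unit_measure) = (\<integral>t. ?A 3 0 t \<partial>unit_measure)"
    by (rule integral_ln_ln_kern_commute)
  finally have "Re (\<integral>t. ?F t \<partial>unit_measure) = 3 * (\<integral>t. ln t ^ 2 * ln (1 - t) * kern t \<partial>unit_measure) +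
      pi\<^sup>2 * (\<integral>t. ln t * kern t \<partial>unit_measure) - 2 * (\<integral>t. ln t ^ 3 * kern t \<partial>unit_measure)"
    by simp
  moreover have "Re (\<integral>t. ?F t \<partial>unit_measure) = 0"
    unfolding fold3_integral(2) by (simp add: fold3_def power2_eq_square)
  ultimately show ?thesis by simp
qed

section \<open>Evaluation of the three sums from the moments\<close>

theorem corollary1p3:
  fixes f :: "real \<Rightarrow> real"
  assumes f: "\<And>x. x > 0 \<Longrightarrow> f x = (Gamma x)\<^sup>2 / (2 * Gamma (2 * x))"
  shows "(\<lambda>k. complex_of_real (deriv f (real (Suc k)))) sums (- (3 / 2) * L_m3 2) \<and>
    (\<lambda>k. complex_of_real ((deriv ^^ 2) f (real (Suc k)))) sums (3 * L_m3 3) \<and>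
    3 * L_m3 3 = complex_of_real (4 * pi ^ 3 / (27 * sqrt 3)) \<and>
    (\<lambda>k. complex_of_real ((deriv ^^ 3) f (real (Suc k)))) sums
      (3 / 4 * (2 * complex_of_real (pi\<^sup>2) * L_m3 2 - 27 * L_m3 4))"
proof -
  let ?A = "\<lambda>i j t. ln t ^ i * ln (1 - t) ^ j * kern t"
  let ?I = "\<lambda>i j. \<integral>t. ?A i j t \<partial>unit_measure"
  note int = integrable_ln_ln_kern and sums = sums_higher_deriv_half_Beta[OF f]
  have L: "L_m3 2 = of_real (L_real 2)" "L_m3 3 = of_real (L_real 3)" "L_m3 4 = of_real (L_real 4)"
    using L_m3_of_nat[of 2] L_m3_of_nat[of 3] L_m3_of_nat[of 4] by simp_all
  have A1: "?I 1 0 = - (3 / 2) * L_real 2"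
    using integral_ln_power_kern[of 1] by (simp add: numeral_2_eq_2)
  have A2: "?I 2 0 = 5 / 2 * L_real 3"
    using integral_ln_power_kern[of 2] by (simp add: fact_numeral power_divide)
  have A3: "?I 3 0 = - (27 / 4) * L_real 4"
    using integral_ln_power_kern[of 3] by (simp add: fact_numeral power_divide)
  have comm: "?I j i = ?I i j" for i j
    by (rule integral_ln_ln_kern_commute)

  have "(\<integral>t. (ln t + ln (1 - t)) ^ 1 * kern t \<partial>unit_measure) = (\<integral>t. ?A 1 0 t + ?A 0 1 t \<partial>unit_measure)"
    by (simp add: algebra_simps)
  also have "\<dots> = ?I 1 0 + ?I 0 1"
    by (intro Bochner_Integration.integral_add int)
  finally have s1: "(\<lambda>k. (deriv ^^ 1) f (real (Suc k))) sums (- (3 / 2) * L_real 2)"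
    using sums[of 1] comm[of 0 1] A1 by simp

  have "(\<integral>t. (ln t + ln (1 - t)) ^ 2 * kern t \<partial>unit_measure) =
      (\<integral>t. (?A 2 0 t + ?A 0 2 t) + 2 * ?A 1 1 t \<partial>unit_measure)"
    by (simp add: power2_eq_square algebra_simps)
  also have "\<dots> = (\<integral>t. ?A 2 0 t + ?A 0 2 t \<partial>unit_measure) + (\<integral>t. 2 * ?A 1 1 t \<partial>unit_measure)"
    by (intro Bochner_Integration.integral_add Bochner_Integration.integrable_add integrable_mult_right int)
  also have "(\<integral>t. 2 * ?A 1 1 t \<partial>unit_measure) = 2 * ?I 1 1" by (rule integral_mult_right_zero)
  also have "(\<integral>t. ?A 2 0 t + ?A 0 2 t \<partial>unit_measure) = ?I 2 0 + ?I 0 2"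
    by (intro Bochner_Integration.integral_add int)
  finally have "(\<integral>t. (ln t + ln (1 - t)) ^ 2 * kern t \<partial>unit_measure) = 2 * ?I 2 0 + 2 * ?I 1 1"
    using comm[of 0 2] by simp
  \<comment> \<open>By \<open>L_real_3\<close> the constant 2 pi^3/(9 sqrt 3) is 9/2
    \<open>L_real 3\<close>, so the quadratic moment is (5 + 10 - 9) \<open>L_real 3\<close>, and
    half of it is the claimed sum.\<close>
  also have "?I 1 1 = 2 * ?I 2 0 - 9 / 2 * L_real 3"
    using integral_ln_ln_kern_1_1 by (simp add: L_real_3)
  finally have s2: "(\<lambda>k. (deriv ^^ 2) f (real (Suc k))) sums (3 * L_real 3)"
    using sums[of 2] unfolding A2 by (simp add: algebra_simps)

  have "(\<integral>t. (ln t + ln (1 - t)) ^ 3 * kern t \<partial>unit_measure) =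
      (\<integral>t. (?A 3 0 t + ?A 0 3 t) + 3 * (?A 2 1 t + ?A 1 2 t) \<partial>unit_measure)"
    by (simp add: power2_eq_square power3_eq_cube algebra_simps)
  also have "\<dots> = (\<integral>t. ?A 3 0 t + ?A 0 3 t \<partial>unit_measure) + (\<integral>t. 3 * (?A 2 1 t + ?A 1 2 t) \<partial>unit_measure)"
    by (intro Bochner_Integration.integral_add Bochner_Integration.integrable_add integrable_mult_right int)
  also have "(\<integral>t. 3 * (?A 2 1 t + ?A 1 2 t) \<partial>unit_measure) = 3 * (\<integral>t. ?A 2 1 t + ?A 1 2 t \<partial>unit_measure)"
    by (rule integral_mult_right_zero)
  also have "(\<integral>t. ?A 2 1 t + ?A 1 2 t \<partial>unit_measure) = ?I 2 1 + ?I 1 2"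
    by (intro Bochner_Integration.integral_add int)
  also have "(\<integral>t. ?A 3 0 t + ?A 0 3 t \<partial>unit_measure) = ?I 3 0 + ?I 0 3"
    by (intro Bochner_Integration.integral_add int)
  finally have "(\<integral>t. (ln t + ln (1 - t)) ^ 3 * kern t \<partial>unit_measure) = 2 * ?I 3 0 + 2 * (3 * ?I 2 1)"
    using comm[of 0 3] comm[of 1 2] by simp
  \<comment> \<open>The cubic moment becomes 6 \<open>?I 3 0\<close> - 2 pi^2 \<open>?I 1 0\<close>:
    only pure moments remain.\<close>
  also have "3 * ?I 2 1 = 2 * ?I 3 0 - pi\<^sup>2 * ?I 1 0"
    using integral_ln_ln_kern_2_1 by simp
  finally have cubic: "(\<integral>t. (ln t + ln (1 - t)) ^ 3 * kern t \<partial>unit_measure) =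
      2 * (3 / 4 * (2 * pi\<^sup>2 * L_real 2 - 27 * L_real 4))"
    unfolding A1 A3 by (simp add: algebra_simps)
  have s3: "(\<lambda>k. (deriv ^^ 3) f (real (Suc k))) sums (3 / 4 * (2 * pi\<^sup>2 * L_real 2 - 27 * L_real 4))"
    using sums[of 3] unfolding cubic by (simp add: diff_divide_distrib)

  show ?thesis
    unfolding L using sums_of_real[OF s1, where ?'a = complex] sums_of_real[OF s2, where ?'a = complex]
      sums_of_real[OF s3, where ?'a = complex]
    by (simp add: L_real_3)
qed

end
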